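(* Let $\gamma_1,\gamma_2$ be non-zero rational numbers, and let $C_1,C_2,s>0$. There exists $\varepsilon_*=\varepsilon_*(C_1,C_2,s,\gamma_1,\gamma_2)>0$ with the following property. Suppose $A\subset[0,1]$ is compact and supports a Borel probability measure $\mu$ such that (1) $|\widehat{\mu}(\xi)|^2\le C_1|\xi|^{-s}$ for all $\xi\in\mathbb{R}\setminus\{0\}$; and (2) $\mu(B(x,r))\le C_2 r^{1-\varepsilon_0}$ for all $x\in\mathbb{R}$ and $r>0$, for some $0<\varepsilon_0\le\varepsilon_*$. Then there exist $x,t\in\mathbb{R}$ with $t\neq0$ such that $$\{x,\;x-\gamma_1t,\;x-\gamma_2t\}\subset A.$$
   Context: $\widehat{\mu}$ denotes the Fourier transform of $\mu$, and $B(x,r)\subset\mathbb{R}$ is the ball (interval) of radius $r$ centred at $x$. "$A$ supports $\mu$" means that $\mu$ is a Borel probability measure with $\operatorname{supp}\mu\subset A$. *)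

theory Defs
  imports "HOL-Probability.Probability"
begin

(* Normalisation: the character is exp (- 2 pi i x xi), so fourier_transform M xi = char M (- 2 pi xi).
   Another usual normalisation only rescales xi, i.e. changes C1 in a bound C1 * |xi| powr (-s). *)
definition fourier_transform :: "real measure \<Rightarrow> real \<Rightarrow> complex" where
  "fourier_transform M \<xi> = (CLINT x|M. exp (- (2 * pi * \<i> * complex_of_real (x * \<xi>))))"

definition msupport :: "'a::topological_space measure \<Rightarrow> 'a set" where
  "msupport M = {x. \<forall>U. open U \<and> x \<in> U \<longrightarrow> emeasure M U > 0}"

(* real_distribution M: M is a Borel probability measure on the real line. *)
definition supports_measure :: "real set \<Rightarrow> real measure \<Rightarrow> bool" where
  "supports_measure A M \<longleftrightarrow> real_distribution M \<and> msupport M \<subseteq> A"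

end

theory Submission
  imports Defs
begin

text \<open>Replace $\gamma_2$ by $2 \gamma_1$ if $\gamma_1 = \gamma_2$, and clear denominators, so that $\gamma_i = p_i$ are distinct non-zero integers, and put
  $W = (p_2 - p_1) X - p_2 Y + p_1 Z$ for independent $X, Y, Z$ with law $\mu$. For a Gaussian kernel
  $\varphi_\delta$ of width $\delta$ and the weight $w = 1 - \cos (X - Y)$ consider
  $Q(\delta) = E [w \varphi_\delta (W)]$. On the Fourier side this is an integral of triple products of
  $\hat\mu$. One factor decays like a power of the frequency, and the other two are in $L^2$ up to a
  factor $R^{\varepsilon_0}$ on $|\xi| \le R$ by the ball condition; hence
  $|Q(\delta) - Q(\delta')| \le C \delta^q$ for $\delta' \le \delta$. If $A$ contains no
  configuration, then $Q(\delta') \to 0$, because $w$ kills the triples with $x = y$, and so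
  $Q(\delta) \le C \delta^q$.

  Now let $\mu$ have density at least $D$ on an interval of length $\ell$, and choose $\delta$ so small
  (depending on $\ell$) that $C \delta^q$ is less than $c D^3 \ell^4$. If no cell of length $\delta$
  had density above $13 D / 12$, then $\mu$ would be so close to uniform at scale $\delta$ that
  counting configurations of cells gives $Q(\delta) \ge c D^3 \ell^4$, a contradiction. So the density
  increases by the factor $13/12$ on a shorter interval. After boundedly many steps it exceeds $2 C_2$,
  at a scale $\rho$ depending only on the parameters, which violates the ball condition as soon as
  $\rho^{-\varepsilon_0} \le 2$.\<close>

subsection \<open>Gaussian averages and characteristic functions\<close>

lemma gaussian_integrable:
  fixes \<delta> :: real
  assumes "\<delta> > 0"
  shows "integrable lborel (\<lambda>\<xi>. exp (- (\<delta> * \<xi>)\<^sup>2 / 2))"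
proof -
  have "integrable lborel (\<lambda>\<xi>. sqrt (2 * pi) * std_normal_density (0 + \<delta> * \<xi>))"
    using lborel_integrable_real_affine[of std_normal_density \<delta> 0] assms
      integrable_normal_density[of 1 0] by (intro integrable_mult_right) auto
  then show ?thesis by (simp add: std_normal_density_def)
qed

text \<open>This is the known characteristic function of the standard normal law, rescaled by the
  substitution \<xi> -> \<delta> \<xi>.\<close>

lemma gaussian_fourier_integral:
  fixes \<delta> x :: real
  assumes "\<delta> > 0"
  shows "(CLINT \<xi>|lborel. complex_of_real (exp (- (\<delta> * \<xi>)\<^sup>2 / 2)) * iexp (\<xi> * x))
    = complex_of_real (sqrt (2 * pi) / \<delta> * exp (- (x / \<delta>)\<^sup>2 / 2))"
proof -
  have "complex_of_real (exp (- (x / \<delta>)\<^sup>2 / 2)) = char std_normal_distribution (x / \<delta>)"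
    by (simp add: char_std_normal_distribution)
  also have "\<dots> = (CLINT \<xi>|lborel. std_normal_density \<xi> *\<^sub>R iexp ((x / \<delta>) * \<xi>))"
    unfolding char_def by (subst integral_density) auto
  also have "\<dots> = \<bar>\<delta>\<bar> *\<^sub>R (CLINT \<xi>|lborel. std_normal_density (0 + \<delta> * \<xi>) *\<^sub>R iexp ((x / \<delta>) * (0 + \<delta> * \<xi>)))"
    using assms by (intro lborel_integral_real_affine) auto
  also have "\<dots> = \<delta> *\<^sub>R (CLINT \<xi>|lborel. (1 / sqrt (2 * pi)) *\<^sub>R (exp (- (\<delta> * \<xi>)\<^sup>2 / 2) * iexp (\<xi> * x)))"
    using assms by (simp add: std_normal_density_def scaleR_conv_of_real mult_ac)
  also have "\<dots> = (\<delta> / sqrt (2 * pi)) *\<^sub>R (CLINT \<xi>|lborel. complex_of_real (exp (- (\<delta> * \<xi>)\<^sup>2 / 2)) * iexp (\<xi> * x))"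
    by (subst integral_scaleR_right) simp
  finally have *: "(\<delta> / sqrt (2 * pi)) *\<^sub>R (CLINT \<xi>|lborel. complex_of_real (exp (- (\<delta> * \<xi>)\<^sup>2 / 2)) * iexp (\<xi> * x))
     = complex_of_real (exp (- (x / \<delta>)\<^sup>2 / 2))" ..
  have "(CLINT \<xi>|lborel. complex_of_real (exp (- (\<delta> * \<xi>)\<^sup>2 / 2)) * iexp (\<xi> * x))
     = (sqrt (2 * pi) / \<delta>) *\<^sub>R ((\<delta> / sqrt (2 * pi)) *\<^sub>R (CLINT \<xi>|lborel. complex_of_real (exp (- (\<delta> * \<xi>)\<^sup>2 / 2)) * iexp (\<xi> * x)))"
    using assms by simp
  then show ?thesis unfolding * by (simp add: scaleR_conv_of_real)
qed

text \<open>Fourier inversion of the kernel followed by Fubini; the Gaussian in \<xi> makes the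
  double integral absolutely convergent. With the kernel left unnormalised, the constant on the
  frequency side is 1 / sqrt (2 pi).\<close>

lemma (in prob_space) expectation_gaussian:
  fixes W :: "'a \<Rightarrow> real" and w :: "'a \<Rightarrow> complex"
  assumes [measurable]: "W \<in> borel_measurable M" "w \<in> borel_measurable M"
    and bnd: "\<And>t. cmod (w t) \<le> B" and "\<delta> > 0"
  shows "(CLINT t|M. w t * complex_of_real (exp (- (W t / \<delta>)\<^sup>2 / 2) / \<delta>))
    = complex_of_real (1 / sqrt (2 * pi)) *
      (CLINT \<xi>|lborel. complex_of_real (exp (- (\<delta> * \<xi>)\<^sup>2 / 2)) * (CLINT t|M. w t * iexp (\<xi> * W t)))"
proof -
  interpret L: pair_sigma_finite M lborel by standard
  have int: "integrable (M \<Otimes>\<^sub>M lborel)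
      (\<lambda>(t, \<xi>). w t * (complex_of_real (exp (- (\<delta> * \<xi>)\<^sup>2 / 2)) * iexp (\<xi> * W t)))"
  proof (rule Bochner_Integration.integrable_bound)
    show "integrable (M \<Otimes>\<^sub>M lborel) (\<lambda>(t, \<xi>). B * exp (- (\<delta> * \<xi>)\<^sup>2 / 2))"
      by (rule L.Fubini_integrable)
        (use gaussian_integrable[OF \<open>\<delta> > 0\<close>] in \<open>auto\<close>)
    show "AE p in M \<Otimes>\<^sub>M lborel. cmod (case p of (t, \<xi>) \<Rightarrow> w t * (complex_of_real (exp (- (\<delta> * \<xi>)\<^sup>2 / 2)) * iexp (\<xi> * W t)))
       \<le> norm (case p of (t, \<xi>) \<Rightarrow> B * exp (- (\<delta> * \<xi>)\<^sup>2 / 2))"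
      by (intro AE_I2)
        (auto simp: norm_mult abs_mult split: prod.split intro!: mult_right_mono order.trans[OF bnd])
  qed measurable
  have "(CLINT t|M. w t * complex_of_real (exp (- (W t / \<delta>)\<^sup>2 / 2) / \<delta>))
     = (CLINT t|M. complex_of_real (1 / sqrt (2 * pi)) * (w t * complex_of_real (sqrt (2 * pi) / \<delta> * exp (- (W t / \<delta>)\<^sup>2 / 2))))"
    by (intro Bochner_Integration.integral_cong) (auto simp: field_simps)
  also have "\<dots> = complex_of_real (1 / sqrt (2 * pi)) * (CLINT t|M. w t * complex_of_real (sqrt (2 * pi) / \<delta> * exp (- (W t / \<delta>)\<^sup>2 / 2)))"
    by (rule integral_mult_right_zero)
  also have "(CLINT t|M. w t * complex_of_real (sqrt (2 * pi) / \<delta> * exp (- (W t / \<delta>)\<^sup>2 / 2)))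
     = (CLINT t|M. (CLINT \<xi>|lborel. w t * (complex_of_real (exp (- (\<delta> * \<xi>)\<^sup>2 / 2)) * iexp (\<xi> * W t))))"
    by (intro Bochner_Integration.integral_cong refl, subst integral_mult_right_zero,
        subst gaussian_fourier_integral[OF \<open>\<delta> > 0\<close>]) simp
  also have "\<dots> = (CLINT \<xi>|lborel. (CLINT t|M. w t * (complex_of_real (exp (- (\<delta> * \<xi>)\<^sup>2 / 2)) * iexp (\<xi> * W t))))"
    using L.Fubini_integral[OF int] by simp
  also have "\<dots> = (CLINT \<xi>|lborel. complex_of_real (exp (- (\<delta> * \<xi>)\<^sup>2 / 2)) * (CLINT t|M. w t * iexp (\<xi> * W t)))"
    by (subst integral_mult_right_zero[symmetric], intro Bochner_Integration.integral_cong refl) (simp add: mult_ac)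
  finally show ?thesis .
qed

lemma ennreal_le_suminf: "f k \<le> (\<Sum>k. f k)" for f :: "nat \<Rightarrow> ennreal"
  using sum_le_suminf[of f "{k}"] by simp

lemma borel_measurable_cnj [measurable (raw)]:
  assumes [measurable]: "f \<in> borel_measurable M"
  shows "(\<lambda>x. cnj (f x)) \<in> borel_measurable M"
proof -
  have "cnj \<in> borel_measurable borel"
    by (intro borel_measurable_continuous_onI continuous_intros)
  from measurable_compose[OF assms this] show ?thesis .
qed

lemma integral_pair_mult:
  fixes f :: "'a \<Rightarrow> complex" and g :: "'b \<Rightarrow> complex"
  assumes "prob_space M" "prob_space N"
    and [measurable]: "f \<in> borel_measurable M" "g \<in> borel_measurable N"
    and f: "\<And>x. cmod (f x) \<le> 1" and g: "\<And>y. cmod (g y) \<le> 1"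
  shows "(CLINT p|M \<Otimes>\<^sub>M N. f (fst p) * g (snd p)) = (CLINT x|M. f x) * (CLINT y|N. g y)"
proof -
  interpret M: prob_space M by fact
  interpret N: prob_space N by fact
  interpret P: pair_prob_space M N ..
  have "integrable (M \<Otimes>\<^sub>M N) (\<lambda>p. f (fst p) * g (snd p))"
    by (rule P.integrable_const_bound[of _ 1])
      (auto simp: norm_mult intro!: mult_le_one f g)
  from P.integral_fst'[OF this] show ?thesis
    by simp
qed


section \<open>Energy estimates from the ball condition\<close>

context real_distribution
begin

text \<open>Dyadic layers: at distance about 2^k / R from y the Gaussian is O(4^-k), while the ball
  condition gives the ball of radius 2^k / R mass at most C 2^k R^(\<epsilon> - 1), so the layers
  sum like 2^-k.\<close>

lemma nn_integral_gaussian_le: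
  assumes ball: "\<And>x r. r > 0 \<Longrightarrow> measure M (ball x r) \<le> C * r powr (1 - \<epsilon>)"
    and \<epsilon>: "0 \<le> \<epsilon>" "\<epsilon> \<le> 1" and R: "R > 0"
  shows "(\<integral>\<^sup>+x. ennreal (exp (- (R * (x - y))\<^sup>2 / 2)) \<partial>M) \<le> ennreal (16 * C * R powr (\<epsilon> - 1))"
proof -
  have C: "C \<ge> 0"
    using order.trans[OF measure_nonneg ball[of 1 0]] by simp
  have pt: "ennreal (exp (- (R * (x - y))\<^sup>2 / 2))
      \<le> (\<Sum>k. ennreal (8 * (1/4)^k) * indicator (ball y (2^k / R)) x)" for x
  proof -
    define u where "u = \<bar>R * (x - y)\<bar>"
    have ex: "\<exists>k. u < 2 ^ k"
      using real_arch_pow[of 2 u] by auto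
    \<comment> \<open>Minimality gives u \<ge> 2^(k-1) unless k = 0; then exp (u^2 / 2) \<ge> u^2 /
      2 produces the constant 8.\<close>
    define k where "k = (LEAST k. u < 2 ^ k)"
    have k: "u < 2 ^ k" unfolding k_def by (rule LeastI_ex[OF ex])
    have "exp (- (R * (x - y))\<^sup>2 / 2) \<le> 8 * (1/4)^k"
    proof (cases k)
      case 0
      then show ?thesis by (simp add: order.trans[of _ 1])
    next
      case (Suc m)
      then have "\<not> u < 2 ^ m"
        unfolding k_def by (metis lessI not_less_Least)
      then have "(2 ^ m)\<^sup>2 \<le> u\<^sup>2" by (intro power_mono) auto
      then have m: "4 ^ m \<le> u\<^sup>2" by (simp add: power2_eq_square flip: power_mult_distrib)
      have "4 ^ m / 2 \<le> exp (u\<^sup>2 / 2)" using exp_ge_add_one_self[of "u\<^sup>2 / 2"] m by linarith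
      then have "1 / exp (u\<^sup>2 / 2) \<le> 1 / (4 ^ m / 2)"
        by (intro divide_left_mono) auto
      also have "\<dots> = 8 * (1/4)^k" by (simp add: Suc field_simps)
      finally show ?thesis by (simp add: u_def exp_minus field_simps)
    qed
    moreover have "x \<in> ball y (2^k / R)"
      using k R by (simp add: u_def dist_real_def abs_mult pos_less_divide_eq abs_minus_commute mult.commute)
    ultimately have "ennreal (exp (- (R * (x - y))\<^sup>2 / 2)) \<le> ennreal (8 * (1/4)^k) * indicator (ball y (2^k / R)) x"
      by (simp add: ennreal_leI)
    also have "\<dots> \<le> (\<Sum>k. ennreal (8 * (1/4)^k) * indicator (ball y (2^k / R)) x)"
      by (rule ennreal_le_suminf)
    finally show ?thesis .
  qed
  have "(\<integral>\<^sup>+x. ennreal (exp (- (R * (x - y))\<^sup>2 / 2)) \<partial>M)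
      \<le> (\<integral>\<^sup>+x. (\<Sum>k. ennreal (8 * (1/4)^k) * indicator (ball y (2^k / R)) x) \<partial>M)"
    by (intro nn_integral_mono pt)
  also have "\<dots> = (\<Sum>k. ennreal (8 * (1/4)^k) * emeasure M (ball y (2^k / R)))"
    by (subst nn_integral_suminf)
      (auto simp: nn_integral_cmult_indicator intro!: borel_measurable_times_ennreal borel_measurable_indicator)
  also have "\<dots> \<le> (\<Sum>k. ennreal (8 * C * R powr (\<epsilon> - 1) * (1/2)^k))"
  proof (intro suminf_le allI summableI)
    fix k :: nat
    have "measure M (ball y (2^k / R)) \<le> C * (2^k / R) powr (1 - \<epsilon>)"
      using R by (intro ball) auto
    also have "(2^k / R) powr (1 - \<epsilon>) = (2^k) powr (1 - \<epsilon>) * R powr (\<epsilon> - 1)"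
      using R powr_minus_divide[of R "1 - \<epsilon>"] by (simp add: powr_divide)
    \<comment> \<open>Rounding the exponent up to 1 is affordable, since 4^-k 2^k is still summable,
      and it keeps the constant free of \<epsilon>.\<close>
    also have "(2^k::real) powr (1 - \<epsilon>) \<le> (2^k) powr 1"
      using \<epsilon> by (intro powr_mono) auto
    finally have "measure M (ball y (2^k / R)) \<le> C * (2^k * R powr (\<epsilon> - 1))"
      using C by (simp add: mult_left_mono mult_right_mono)
    then have "8 * (1/4)^k * measure M (ball y (2^k / R)) \<le> 8 * (1/4)^k * (C * (2^k * R powr (\<epsilon> - 1)))"
      by (intro mult_left_mono) auto
    also have "\<dots> = 8 * C * R powr (\<epsilon> - 1) * ((1/4)^k * 2^k)" by simp
    also have "(1/4)^k * 2^k = (1/2::real)^k" by (simp flip: power_mult_distrib)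
    finally show "ennreal (8 * (1/4)^k) * emeasure M (ball y (2^k / R)) \<le> ennreal (8 * C * R powr (\<epsilon> - 1) * (1/2)^k)"
      by (simp add: emeasure_eq_measure ennreal_leI flip: ennreal_mult)
  qed
  also have "\<dots> = ennreal (16 * C * R powr (\<epsilon> - 1))"
    using C sums_mult[OF geometric_sums[of "1/2::real"], of "8 * C * R powr (\<epsilon> - 1)"]
    by (intro suminf_ennreal_eq) (auto simp: mult.assoc)
  finally show ?thesis .
qed

text \<open>\<open>(cmod (char M \<xi>))\<^sup>2\<close> is the characteristic function of X - Y for
  independent X, Y with law M. So \<open>expectation_gaussian\<close> at width 1 / R turns the
  energy on |\<xi>| up to about R into a Gaussian average of X - Y, which the ball condition
  controls for each fixed Y.\<close>

lemma nn_integral_gaussian_char: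
  assumes ball: "\<And>x r. r > 0 \<Longrightarrow> measure M (ball x r) \<le> C * r powr (1 - \<epsilon>)"
    and \<epsilon>: "0 \<le> \<epsilon>" "\<epsilon> \<le> 1" and R: "R > 0"
  shows "(\<integral>\<^sup>+\<xi>. ennreal (exp (- (\<xi> / R)\<^sup>2 / 2) * (cmod (char M \<xi>))\<^sup>2) \<partial>lborel)
    \<le> ennreal (16 * sqrt (2 * pi) * C * R powr \<epsilon>)"
proof -
  interpret P: pair_prob_space M M ..
  have C: "C \<ge> 0"
    using order.trans[OF measure_nonneg ball[of 1 0]] by simp
  have inner: "(CLINT p|M \<Otimes>\<^sub>M M. 1 * iexp (\<xi> * (fst p - snd p))) = complex_of_real ((cmod (char M \<xi>))\<^sup>2)" for \<xi>
  proof -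
    have "(CLINT p|M \<Otimes>\<^sub>M M. 1 * iexp (\<xi> * (fst p - snd p)))
       = (CLINT p|M \<Otimes>\<^sub>M M. iexp (\<xi> * fst p) * cnj (iexp (\<xi> * snd p)))"
      by (intro Bochner_Integration.integral_cong refl)
        (simp add: exp_cnj right_diff_distrib flip: exp_add)
    also have "\<dots> = char M \<xi> * (CLINT y|M. cnj (iexp (\<xi> * y)))"
      unfolding char_def by (rule integral_pair_mult) (auto simp: prob_space_axioms)
    also have "(CLINT y|M. cnj (iexp (\<xi> * y))) = cnj (char M \<xi>)"
      unfolding char_def by (rule Bochner_Integration.integral_cnj)
    finally show ?thesis by (simp only: complex_norm_square)
  qed
  have int: "integrable lborel (\<lambda>\<xi>. exp (- (\<xi> / R)\<^sup>2 / 2) * (cmod (char M \<xi>))\<^sup>2)"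
  proof (rule Bochner_Integration.integrable_bound)
    show "integrable lborel (\<lambda>\<xi>. exp (- (1 / R * \<xi>)\<^sup>2 / 2))"
      using R by (intro gaussian_integrable) simp
    show "AE \<xi> in lborel. norm (exp (- (\<xi> / R)\<^sup>2 / 2) * (cmod (char M \<xi>))\<^sup>2)
        \<le> norm (exp (- (1 / R * \<xi>)\<^sup>2 / 2))"
      by (intro AE_I2) (simp add: abs_mult mult_left_le power_le_one cmod_char_le_1)
  qed simp
  have "complex_of_real (LINT \<xi>|lborel. exp (- (\<xi> / R)\<^sup>2 / 2) * (cmod (char M \<xi>))\<^sup>2)
    = (CLINT \<xi>|lborel. complex_of_real (exp (- ((1/R) * \<xi>)\<^sup>2 / 2)) * (CLINT p|M \<Otimes>\<^sub>M M. 1 * iexp (\<xi> * (fst p - snd p))))"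
    by (simp only: inner flip: of_real_mult integral_complex_of_real) simp
  also have "\<dots> = complex_of_real (sqrt (2 * pi)) * (CLINT p|M \<Otimes>\<^sub>M M. 1 * complex_of_real (exp (- ((fst p - snd p) / (1/R))\<^sup>2 / 2) / (1/R)))"
    by (subst P.expectation_gaussian[of _ _ 1]) (use R in auto)
  also have "\<dots> = complex_of_real (sqrt (2 * pi) * (LINT p|(M \<Otimes>\<^sub>M M). R * exp (- (R * (fst p - snd p))\<^sup>2 / 2)))"
    by (simp add: mult_ac flip: integral_complex_of_real)
  finally have eq: "(LINT \<xi>|lborel. exp (- (\<xi> / R)\<^sup>2 / 2) * (cmod (char M \<xi>))\<^sup>2)
     = sqrt (2 * pi) * (R * (LINT p|(M \<Otimes>\<^sub>M M). exp (- (R * (fst p - snd p))\<^sup>2 / 2)))"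
    unfolding of_real_eq_iff by simp
  have "ennreal (LINT p|(M \<Otimes>\<^sub>M M). exp (- (R * (fst p - snd p))\<^sup>2 / 2))
     = (\<integral>\<^sup>+p. ennreal (exp (- (R * (fst p - snd p))\<^sup>2 / 2)) \<partial>(M \<Otimes>\<^sub>M M))"
    by (rule nn_integral_eq_integral[symmetric])
       (auto intro!: P.integrable_const_bound[of _ 1])
  also have "\<dots> = (\<integral>\<^sup>+y. \<integral>\<^sup>+x. ennreal (exp (- (R * (x - y))\<^sup>2 / 2)) \<partial>M \<partial>M)"
    by (subst P.nn_integral_snd[symmetric]) auto
  also have "\<dots> \<le> (\<integral>\<^sup>+y. ennreal (16 * C * R powr (\<epsilon> - 1)) \<partial>M)"
    by (intro nn_integral_mono nn_integral_gaussian_le ball \<epsilon> R)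
  also have "\<dots> = ennreal (16 * C * R powr (\<epsilon> - 1))"
    using emeasure_space_1 by simp
  finally have "(LINT p|(M \<Otimes>\<^sub>M M). exp (- (R * (fst p - snd p))\<^sup>2 / 2)) \<le> 16 * C * R powr (\<epsilon> - 1)"
    using C by (simp add: ennreal_le_iff)
  then have "sqrt (2 * pi) * (R * (LINT p|(M \<Otimes>\<^sub>M M). exp (- (R * (fst p - snd p))\<^sup>2 / 2)))
     \<le> sqrt (2 * pi) * (R * (16 * C * R powr (\<epsilon> - 1)))"
    using R by (intro mult_left_mono) auto
  also have "\<dots> = 16 * sqrt (2 * pi) * C * R powr \<epsilon>"
    using R by (simp add: powr_diff)
  finally have "(LINT \<xi>|lborel. exp (- (\<xi> / R)\<^sup>2 / 2) * (cmod (char M \<xi>))\<^sup>2)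
     \<le> 16 * sqrt (2 * pi) * C * R powr \<epsilon>"
    unfolding eq .
  then show ?thesis
    using nn_integral_eq_integral[OF int] by (simp add: ennreal_leI)
qed

text \<open>Frequencies of size about 2^j contribute at most a constant times 2^(-j q) 2^(j
  \<epsilon>), and \<epsilon> \<le> q / 2 makes this a geometric series of ratio 2^(-q/2). The bound
  does not involve \<epsilon>, so the threshold for \<epsilon> can be chosen afterwards.\<close>

lemma nn_integral_char_weighted:
  assumes ball: "\<And>x r. r > 0 \<Longrightarrow> measure M (ball x r) \<le> C * r powr (1 - \<epsilon>)"
    and q: "0 < q" "q \<le> 1" and \<epsilon>: "0 \<le> \<epsilon>" "\<epsilon> \<le> q / 2"
  shows "(\<integral>\<^sup>+\<xi>. ennreal ((1 + \<bar>\<xi>\<bar>) powr - q * (cmod (char M \<xi>))\<^sup>2) \<partial>lborel)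
    \<le> ennreal (64 * sqrt (2 * pi) * C / (1 - 2 powr (- q / 2)))"
proof -
  have C: "C \<ge> 0"
    using order.trans[OF measure_nonneg ball[of 1 0]] by simp
  have pt: "ennreal ((1 + \<bar>\<xi>\<bar>) powr - q * (cmod (char M \<xi>))\<^sup>2)
      \<le> (\<Sum>j. ennreal (4 * (2^j) powr - q) * ennreal (exp (- (\<xi> / 2^j)\<^sup>2 / 2) * (cmod (char M \<xi>))\<^sup>2))" for \<xi>
  proof -
    have ex: "\<exists>k. \<bar>\<xi>\<bar> < 2 ^ k"
      using real_arch_pow[of 2 "\<bar>\<xi>\<bar>"] by auto
    define k where "k = (LEAST k. \<bar>\<xi>\<bar> < 2 ^ k)"
    have k: "\<bar>\<xi>\<bar> < 2 ^ k" unfolding k_def by (rule LeastI_ex[OF ex])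
    \<comment> \<open>The factor 2 is the dyadic rounding 2 powr q; the Gaussian, at least 1/2 where
      |\<xi>| < 2^k, costs another 2, hence the 4 in the series.\<close>
    have 1: "(1 + \<bar>\<xi>\<bar>) powr - q \<le> 2 * (2^k) powr - q"
    proof (cases k)
      case 0
      then show ?thesis using q powr_mono2'[of "-q" 1 "1 + \<bar>\<xi>\<bar>"] by simp
    next
      case (Suc m)
      then have "\<not> \<bar>\<xi>\<bar> < 2 ^ m"
        unfolding k_def by (metis lessI not_less_Least)
      then have "(1 + \<bar>\<xi>\<bar>) powr - q \<le> (2^m) powr - q"
        using q by (intro powr_mono2') auto
      also have "(2^m) powr - q = 2 powr q * (2^k) powr - q"
        by (simp only: Suc power_Suc powr_mult) (simp flip: powr_add add: mult.assoc[symmetric])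
      also have "\<dots> \<le> 2 powr 1 * (2^k) powr - q"
        using q by (intro mult_right_mono powr_mono) auto
      finally show ?thesis by simp
    qed
    have "(\<xi> / 2^k)\<^sup>2 \<le> 1"
      using k by (simp only: abs_square_le_1) simp
    then have 2: "1 / 2 \<le> exp (- (\<xi> / 2^k)\<^sup>2 / 2)"
      using exp_ge_add_one_self[of "- (\<xi> / 2^k)\<^sup>2 / 2"] by simp
    have "(1 + \<bar>\<xi>\<bar>) powr - q \<le> (4 * (2^k) powr - q) * (1 / 2)"
      using 1 by simp
    also have "\<dots> \<le> (4 * (2^k) powr - q) * exp (- (\<xi> / 2^k)\<^sup>2 / 2)"
      using 2 by (intro mult_left_mono) auto
    finally have "(1 + \<bar>\<xi>\<bar>) powr - q * (cmod (char M \<xi>))\<^sup>2 \<le> (4 * (2^k) powr - q) * (exp (- (\<xi> / 2^k)\<^sup>2 / 2) * (cmod (char M \<xi>))\<^sup>2)"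
      by (simp add: mult_right_mono flip: mult.assoc)
    then have "ennreal ((1 + \<bar>\<xi>\<bar>) powr - q * (cmod (char M \<xi>))\<^sup>2)
       \<le> ennreal (4 * (2^k) powr - q) * ennreal (exp (- (\<xi> / 2^k)\<^sup>2 / 2) * (cmod (char M \<xi>))\<^sup>2)"
      by (simp add: ennreal_leI flip: ennreal_mult)
    also have "\<dots> \<le> (\<Sum>j. ennreal (4 * (2^j) powr - q) * ennreal (exp (- (\<xi> / 2^j)\<^sup>2 / 2) * (cmod (char M \<xi>))\<^sup>2))"
      by (rule ennreal_le_suminf)
    finally show ?thesis .
  qed
  define z :: real where "z = 2 powr (- q / 2)"
  have z: "0 < z" "z < 1"
    using q by (auto simp: z_def powr_less_one)
  have "(\<integral>\<^sup>+\<xi>. ennreal ((1 + \<bar>\<xi>\<bar>) powr - q * (cmod (char M \<xi>))\<^sup>2) \<partial>lborel)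
    \<le> (\<integral>\<^sup>+\<xi>. (\<Sum>j. ennreal (4 * (2^j) powr - q) * ennreal (exp (- (\<xi> / 2^j)\<^sup>2 / 2) * (cmod (char M \<xi>))\<^sup>2)) \<partial>lborel)"
    by (intro nn_integral_mono pt)
  also have "\<dots> = (\<Sum>j. ennreal (4 * (2^j) powr - q) * (\<integral>\<^sup>+\<xi>. ennreal (exp (- (\<xi> / 2^j)\<^sup>2 / 2) * (cmod (char M \<xi>))\<^sup>2) \<partial>lborel))"
    by (subst nn_integral_suminf) (auto simp: nn_integral_cmult)
  also have "\<dots> \<le> (\<Sum>j. ennreal (64 * sqrt (2 * pi) * C * z ^ j))"
  proof (intro suminf_le allI summableI)
    fix j :: nat
    have "ennreal (4 * (2^j) powr - q) * (\<integral>\<^sup>+\<xi>. ennreal (exp (- (\<xi> / 2^j)\<^sup>2 / 2) * (cmod (char M \<xi>))\<^sup>2) \<partial>lborel)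
      \<le> ennreal (4 * (2^j) powr - q) * ennreal (16 * sqrt (2 * pi) * C * (2^j) powr \<epsilon>)"
      using q \<epsilon> by (intro mult_left_mono nn_integral_gaussian_char ball) auto
    also have "\<dots> = ennreal (64 * sqrt (2 * pi) * C * ((2^j) powr - q * (2^j) powr \<epsilon>))"
      using C by (simp add: mult_ac flip: ennreal_mult)
    also have "\<dots> \<le> ennreal (64 * sqrt (2 * pi) * C * z ^ j)"
    proof (intro ennreal_leI mult_left_mono)
      have "(2^j::real) powr - q * (2^j) powr \<epsilon> = (2^j) powr (\<epsilon> - q)" by (simp flip: powr_add)
      also have "\<dots> \<le> (2^j) powr (- q / 2)" using \<epsilon> q by (intro powr_mono) auto
      also have "\<dots> = z ^ j" by (simp add: z_def powr_power powr_powr mult_ac flip: powr_realpow)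
      finally show "(2^j::real) powr - q * (2^j) powr \<epsilon> \<le> z ^ j" .
    qed (use C in auto)
    finally show "ennreal (4 * (2^j) powr - q) * (\<integral>\<^sup>+\<xi>. ennreal (exp (- (\<xi> / 2^j)\<^sup>2 / 2) * (cmod (char M \<xi>))\<^sup>2) \<partial>lborel)
       \<le> ennreal (64 * sqrt (2 * pi) * C * z ^ j)" .
  qed
  also have "\<dots> = ennreal (64 * sqrt (2 * pi) * C / (1 - z))"
    using C z sums_mult[OF geometric_sums[of z], of "64 * sqrt (2 * pi) * C"] by (intro suminf_ennreal_eq) auto
  finally show ?thesis by (simp add: z_def)
qed

end

subsection \<open>The weighted configuration form\<close>

text \<open>Used with a = p2 - p1, b = -p2, c = p1, where a x + b y + c z = 0 says that y = x - p1 u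
  and z = x - p2 u for some u. Coefficients of modulus at least 1 make \<xi> -> d \<xi>
  non-contracting, so decay and energy bounds survive the dilation up to constants.\<close>

locale linear_pattern = real_distribution M for M +
  fixes a b c :: real
  assumes coeffs: "1 \<le> \<bar>a\<bar>" "1 \<le> \<bar>b\<bar>" "1 \<le> \<bar>c\<bar>"
begin

abbreviation M3 :: "(real \<times> real \<times> real) measure" where
  "M3 \<equiv> M \<Otimes>\<^sub>M (M \<Otimes>\<^sub>M M)"

definition lin :: "real \<times> real \<times> real \<Rightarrow> real" where
  "lin p = a * fst p + b * fst (snd p) + c * snd (snd p)"

text \<open>The weight vanishes on the degenerate triples $x = y$, yet it is a trigonometric
  polynomial, so that inserting it only shifts the frequencies of the characteristic function.\<close>
definition weight :: "real \<times> real \<times> real \<Rightarrow> real" where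
  "weight p = 1 - cos (fst p - fst (snd p))"

text \<open>This is Q(\<delta>): a smoothed, weighted count of the triples with
  |\<open>lin p\<close>| at most about \<delta>. The kernel is left without its factor 1 / sqrt (2
  pi).\<close>

definition form :: "real \<Rightarrow> real" where
  "form \<delta> = (LINT p|M3. weight p * (exp (- (lin p / \<delta>)\<^sup>2 / 2) / \<delta>))"

lemma prob_space_M3: "prob_space M3"
proof -
  interpret P: pair_prob_space M M ..
  interpret Q: pair_prob_space M "M \<Otimes>\<^sub>M M" ..
  show ?thesis by (rule Q.prob_space_axioms)
qed

sublocale M3: prob_space M3
  by (rule prob_space_M3)

lemma lin_measurable [measurable]: "lin \<in> borel_measurable M3"
  unfolding lin_def by measurable

lemma weight_measurable [measurable]: "weight \<in> borel_measurable M3"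
  unfolding weight_def by measurable

lemma weight_bounds: "0 \<le> weight p" "weight p \<le> 2"
  using cos_le_one[of "fst p - fst (snd p)"] cos_ge_minus_one[of "fst p - fst (snd p)"]
  unfolding weight_def by linarith+

text \<open>The expectation of \<open>iexp (\<xi> * lin p)\<close> times the character with
  frequency h in x and k in y. The shifts that occur have h = -k equal to 0, 1 or -1 and come from
  the exponentials in \<open>weight\<close>.\<close>

definition triple_char :: "real \<Rightarrow> real \<Rightarrow> real \<Rightarrow> complex" where
  "triple_char h k \<xi> = char M (a * \<xi> + h) * (char M (b * \<xi> + k) * char M (c * \<xi>))"

lemma triple_char_measurable [measurable]: "triple_char h k \<in> borel_measurable borel"
  unfolding triple_char_def by measurable

lemma integral_triple:
  "(CLINT p|M3. iexp (u * fst p) * (iexp (v * fst (snd p)) * iexp (s * snd (snd p))))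
    = char M u * (char M v * char M s)"
proof -
  interpret P: pair_prob_space M M ..
  have "(CLINT p|M3. iexp (u * fst p) * (iexp (v * fst (snd p)) * iexp (s * snd (snd p))))
     = (CLINT x|M. iexp (u * x)) * (CLINT p|(M \<Otimes>\<^sub>M M). iexp (v * fst p) * iexp (s * snd p))"
    by (rule integral_pair_mult[of _ _ _ "\<lambda>p. iexp (v * fst p) * iexp (s * snd p)"])
      (auto simp: norm_mult prob_space_axioms P.prob_space_axioms)
  also have "(CLINT p|(M \<Otimes>\<^sub>M M). iexp (v * fst p) * iexp (s * snd p)) = (CLINT x|M. iexp (v * x)) * (CLINT x|M. iexp (s * x))"
    by (rule integral_pair_mult) (auto simp: prob_space_axioms)
  finally show ?thesis by (simp add: char_def)
qed

lemma integral_iexp_lin: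
  "(CLINT p|M3. 1 * iexp (\<xi> * lin p)) = triple_char 0 0 \<xi>"
proof -
  have "(CLINT p|M3. 1 * iexp (\<xi> * lin p))
     = (CLINT p|M3. iexp (a * \<xi> * fst p) * (iexp (b * \<xi> * fst (snd p)) * iexp (c * \<xi> * snd (snd p))))"
    by (intro Bochner_Integration.integral_cong refl) (simp add: lin_def algebra_simps flip: exp_add)
  then show ?thesis by (simp only: integral_triple) (simp add: triple_char_def)
qed

text \<open>Euler's formula for the cosine splits the weighted integrand into three pure characters,
  and independence factorises the integral of each.\<close>

lemma integral_weight_iexp_lin:
  "(CLINT p|M3. complex_of_real (weight p) * iexp (\<xi> * lin p))
    = triple_char 0 0 \<xi> - (triple_char 1 (-1) \<xi> + triple_char (-1) 1 \<xi>) / 2"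
proof -
  let ?E = "\<lambda>h k p. iexp ((a * \<xi> + h) * fst p) * (iexp ((b * \<xi> + k) * fst (snd p)) * iexp (c * \<xi> * snd (snd p)))"
  have int: "integrable M3 (?E h k)" for h k
    by (rule M3.integrable_const_bound[of _ 1]) (auto simp: norm_mult)
  have "complex_of_real (weight p) * iexp (\<xi> * lin p) = ?E 0 0 p - (?E 1 (-1) p + ?E (-1) 1 p) / 2" for p
  proof -
    have "complex_of_real (weight p) = 1 - (iexp (fst p - fst (snd p)) + iexp (- (fst p - fst (snd p)))) / 2"
      using cos_exp_eq[of "complex_of_real (fst p - fst (snd p))"]
      by (simp add: weight_def algebra_simps cos_of_real[symmetric] del: cos_of_real)
    moreover have "?E h k p = iexp (h * fst p + k * fst (snd p)) * iexp (\<xi> * lin p)" for h k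
      by (simp add: lin_def algebra_simps flip: exp_add)
    ultimately show ?thesis
      by (simp only:) (simp add: algebra_simps add_divide_distrib)
  qed
  then have "(CLINT p|M3. complex_of_real (weight p) * iexp (\<xi> * lin p))
     = (CLINT p|M3. ?E 0 0 p - (?E 1 (-1) p + ?E (-1) 1 p) / 2)"
    by (simp only:)
  also have "\<dots> = (CLINT p|M3. ?E 0 0 p) - ((CLINT p|M3. ?E 1 (-1) p) + (CLINT p|M3. ?E (-1) 1 p)) / 2"
    by (simp only: Bochner_Integration.integral_diff Bochner_Integration.integral_add int
        Bochner_Integration.integrable_add integrable_divide integral_divide_zero)
  finally show ?thesis
    by (simp only: integral_triple) (simp add: triple_char_def)
qed

text \<open>The substitution of h + d \<xi> for the frequency has factor 1 / |d| \<le> 1, and 1 + |h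
  + d \<xi>| \<le> (2 + |d|) (1 + |\<xi>|) compares the weights; as q \<le> 1, the loss is at most 2
  + |d|.\<close>

lemma nn_integral_char_shift:
  assumes energy: "(\<integral>\<^sup>+\<xi>. ennreal ((1 + \<bar>\<xi>\<bar>) powr - q * (cmod (char M \<xi>))\<^sup>2) \<partial>lborel) \<le> ennreal K"
    and q: "0 \<le> q" "q \<le> 1" and d: "1 \<le> \<bar>d\<bar>" and h: "\<bar>h\<bar> \<le> 1"
  shows "(\<integral>\<^sup>+\<xi>. ennreal ((1 + \<bar>\<xi>\<bar>) powr - q * (cmod (char M (d * \<xi> + h)))\<^sup>2) \<partial>lborel)
    \<le> ennreal ((2 + \<bar>d\<bar>) * K)"
proof -
  let ?f = "\<lambda>\<xi>. ennreal ((1 + \<bar>\<xi>\<bar>) powr - q * (cmod (char M \<xi>))\<^sup>2)"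
  have pt: "ennreal ((1 + \<bar>\<xi>\<bar>) powr - q * (cmod (char M (d * \<xi> + h)))\<^sup>2) \<le> ennreal (2 + \<bar>d\<bar>) * ?f (h + d * \<xi>)" for \<xi>
  proof -
    have "\<bar>h + d * \<xi>\<bar> \<le> 1 + \<bar>d\<bar> * \<bar>\<xi>\<bar>" using h abs_triangle_ineq[of h "d * \<xi>"] by (simp add: abs_mult)
    then have "1 + \<bar>h + d * \<xi>\<bar> \<le> (2 + \<bar>d\<bar>) * (1 + \<bar>\<xi>\<bar>)" by (simp add: algebra_simps)
    then have "((2 + \<bar>d\<bar>) * (1 + \<bar>\<xi>\<bar>)) powr - q \<le> (1 + \<bar>h + d * \<xi>\<bar>) powr - q"
      using q by (intro powr_mono2') auto
    then have "(2 + \<bar>d\<bar>) powr - q * (1 + \<bar>\<xi>\<bar>) powr - q \<le> (1 + \<bar>h + d * \<xi>\<bar>) powr - q"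
      by (simp add: powr_mult)
    then have "(2 + \<bar>d\<bar>) powr q * ((2 + \<bar>d\<bar>) powr - q * (1 + \<bar>\<xi>\<bar>) powr - q) \<le> (2 + \<bar>d\<bar>) powr q * (1 + \<bar>h + d * \<xi>\<bar>) powr - q"
      by (intro mult_left_mono) auto
    also have "(2 + \<bar>d\<bar>) powr q \<le> (2 + \<bar>d\<bar>) powr 1" using q by (intro powr_mono) auto
    finally have "(1 + \<bar>\<xi>\<bar>) powr - q \<le> (2 + \<bar>d\<bar>) * (1 + \<bar>h + d * \<xi>\<bar>) powr - q"
      using d by (simp add: mult_right_mono add_nonneg_eq_0_iff flip: mult.assoc powr_add)
    then have "(1 + \<bar>\<xi>\<bar>) powr - q * (cmod (char M (d * \<xi> + h)))\<^sup>2 \<le> (2 + \<bar>d\<bar>) * ((1 + \<bar>h + d * \<xi>\<bar>) powr - q * (cmod (char M (h + d * \<xi>)))\<^sup>2)"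
      by (simp add: mult_right_mono add.commute flip: mult.assoc)
    from ennreal_leI[OF this] show ?thesis
      by (simp only: ennreal_mult'[OF add_nonneg_nonneg[OF _ abs_ge_zero]] zero_le_numeral)
  qed
  have "(\<integral>\<^sup>+\<xi>. ennreal ((1 + \<bar>\<xi>\<bar>) powr - q * (cmod (char M (d * \<xi> + h)))\<^sup>2) \<partial>lborel)
     \<le> (\<integral>\<^sup>+\<xi>. ennreal (2 + \<bar>d\<bar>) * ?f (h + d * \<xi>) \<partial>lborel)"
    by (intro nn_integral_mono pt)
  also have "\<dots> = ennreal (2 + \<bar>d\<bar>) * (\<integral>\<^sup>+\<xi>. ?f (h + d * \<xi>) \<partial>lborel)"
    by (intro nn_integral_cmult) measurable
  also have "(\<integral>\<^sup>+\<xi>. ?f (h + d * \<xi>) \<partial>lborel) \<le> ennreal \<bar>d\<bar> * (\<integral>\<^sup>+\<xi>. ?f (h + d * \<xi>) \<partial>lborel)"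
    using d mult_right_mono[of 1 "ennreal \<bar>d\<bar>" "\<integral>\<^sup>+\<xi>. ?f (h + d * \<xi>) \<partial>lborel"] by simp
  also have "\<dots> = (\<integral>\<^sup>+\<xi>. ?f \<xi> \<partial>lborel)"
    using d by (intro nn_integral_real_affine[symmetric]) auto
  also have "\<dots> \<le> ennreal K" by (rule energy)
  finally show ?thesis by (simp add: ennreal_mult' mult_left_mono)
qed

end

section \<open>Fourier bounds under decay and finite energy\<close>

text \<open>The decay exponent 2 q is spent in two halves: one q pays for the weight in the energy
  of the other two factors, the remaining q becomes the power of \<delta> gained in
  \<open>form_diff_le\<close>. The constants are locale parameters so that one choice of scale
  serves every measure sharing them.\<close>

locale decaying_pattern = linear_pattern +
  fixes q K B :: real
  assumes q: "0 < q" "q \<le> 1"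
    and energy: "(\<integral>\<^sup>+\<xi>. ennreal ((1 + \<bar>\<xi>\<bar>) powr - q * (cmod (char M \<xi>))\<^sup>2) \<partial>lborel) \<le> ennreal K"
    and decay: "\<And>\<xi>. cmod (char M \<xi>) \<le> B * (1 + \<bar>\<xi>\<bar>) powr (- 2 * q)"
    and K: "K \<ge> 0"
begin

definition triple_bound :: real where
  "triple_bound = B * K * (4 + \<bar>a\<bar> + \<bar>b\<bar>)"

lemma B_nonneg: "B \<ge> 0"
  using order.trans[OF norm_ge_zero decay[of 0]] by simp

lemma triple_bound_nonneg: "triple_bound \<ge> 0"
  using B_nonneg K by (simp add: triple_bound_def)

text \<open>The third factor is bounded pointwise by \<open>decay\<close>, using |c| \<ge> 1; the
  other two are separated by X Y \<le> X^2 + Y^2 and integrated with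
  \<open>nn_integral_char_shift\<close>.\<close>

lemma nn_integral_triple_char:
  assumes h: "\<bar>h\<bar> \<le> 1" "\<bar>k\<bar> \<le> 1"
  shows "(\<integral>\<^sup>+\<xi>. ennreal ((1 + \<bar>\<xi>\<bar>) powr q * cmod (triple_char h k \<xi>)) \<partial>lborel) \<le> ennreal triple_bound"
proof -
  let ?g = "\<lambda>d h \<xi>. ennreal ((1 + \<bar>\<xi>\<bar>) powr - q * (cmod (char M (d * \<xi> + h)))\<^sup>2)"
  have pt: "ennreal ((1 + \<bar>\<xi>\<bar>) powr q * cmod (triple_char h k \<xi>)) \<le> ennreal B * (?g a h \<xi> + ?g b k \<xi>)" for \<xi>
  proof -
    define X where "X = cmod (char M (a * \<xi> + h))"
    define Y where "Y = cmod (char M (b * \<xi> + k))"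
    define p where "p = (1 + \<bar>\<xi>\<bar>) powr - q"
    have XY: "X * Y \<le> X\<^sup>2 + Y\<^sup>2"
      using sum_squares_bound[of X Y] zero_le_power2[of X] zero_le_power2[of Y] by linarith
    have "1 * \<bar>\<xi>\<bar> \<le> \<bar>c\<bar> * \<bar>\<xi>\<bar>" using coeffs by (intro mult_right_mono) auto
    then have "(1 + \<bar>c * \<xi>\<bar>) powr (- 2 * q) \<le> (1 + \<bar>\<xi>\<bar>) powr (- 2 * q)"
      using q by (intro powr_mono2') (auto simp: abs_mult)
    then have "cmod (char M (c * \<xi>)) \<le> B * (1 + \<bar>\<xi>\<bar>) powr (- 2 * q)"
      using order.trans[OF decay[of "c * \<xi>"] mult_left_mono[OF _ B_nonneg]] by blast
    then have "(1 + \<bar>\<xi>\<bar>) powr q * cmod (char M (c * \<xi>)) \<le> (1 + \<bar>\<xi>\<bar>) powr q * (B * (1 + \<bar>\<xi>\<bar>) powr (- 2 * q))"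
      by (intro mult_left_mono) auto
    also have "\<dots> = B * ((1 + \<bar>\<xi>\<bar>) powr q * (1 + \<bar>\<xi>\<bar>) powr (- 2 * q))"
      by simp
    also have "(1 + \<bar>\<xi>\<bar>) powr q * (1 + \<bar>\<xi>\<bar>) powr (- 2 * q) = p"
      by (simp add: p_def flip: powr_add)
    finally have c: "(1 + \<bar>\<xi>\<bar>) powr q * cmod (char M (c * \<xi>)) \<le> B * p" .
    have "(1 + \<bar>\<xi>\<bar>) powr q * cmod (triple_char h k \<xi>) = ((1 + \<bar>\<xi>\<bar>) powr q * cmod (char M (c * \<xi>))) * (X * Y)"
      by (simp add: triple_char_def norm_mult X_def Y_def)
    also have "\<dots> \<le> (B * p) * (X * Y)"
      using c by (intro mult_right_mono) (auto simp: X_def Y_def)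
    also have "\<dots> \<le> (B * p) * (X\<^sup>2 + Y\<^sup>2)"
      using XY B_nonneg by (intro mult_left_mono) (auto simp: p_def)
    also have "\<dots> = B * (p * X\<^sup>2 + p * Y\<^sup>2)" by (simp add: algebra_simps)
    finally have "ennreal ((1 + \<bar>\<xi>\<bar>) powr q * cmod (triple_char h k \<xi>)) \<le> ennreal (B * (p * X\<^sup>2 + p * Y\<^sup>2))"
      by (rule ennreal_leI)
    also have "\<dots> = ennreal B * (ennreal (p * X\<^sup>2) + ennreal (p * Y\<^sup>2))"
      using B_nonneg by (simp add: p_def flip: ennreal_plus ennreal_mult)
    finally show ?thesis by (simp add: p_def X_def Y_def)
  qed
  have "(\<integral>\<^sup>+\<xi>. ennreal ((1 + \<bar>\<xi>\<bar>) powr q * cmod (triple_char h k \<xi>)) \<partial>lborel)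
    \<le> (\<integral>\<^sup>+\<xi>. ennreal B * (?g a h \<xi> + ?g b k \<xi>) \<partial>lborel)"
    by (intro nn_integral_mono pt)
  also have "\<dots> = ennreal B * ((\<integral>\<^sup>+\<xi>. ?g a h \<xi> \<partial>lborel) + (\<integral>\<^sup>+\<xi>. ?g b k \<xi> \<partial>lborel))"
    by (subst nn_integral_cmult, measurable, subst nn_integral_add) auto
  also have "\<dots> \<le> ennreal B * (ennreal ((2 + \<bar>a\<bar>) * K) + ennreal ((2 + \<bar>b\<bar>) * K))"
    using q by (intro mult_left_mono add_mono nn_integral_char_shift energy h coeffs) auto
  also have "\<dots> = ennreal triple_bound"
    using B_nonneg K by (simp add: triple_bound_def algebra_simps flip: ennreal_plus ennreal_mult)
  finally show ?thesis .
qed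

lemma powr_triple_char_integrable:
  assumes h: "\<bar>h\<bar> \<le> 1" "\<bar>k\<bar> \<le> 1"
  shows "integrable lborel (\<lambda>\<xi>. (1 + \<bar>\<xi>\<bar>) powr q * cmod (triple_char h k \<xi>))"
    and "(LINT \<xi>|lborel. (1 + \<bar>\<xi>\<bar>) powr q * cmod (triple_char h k \<xi>)) \<le> triple_bound"
proof -
  note bd = nn_integral_triple_char[OF h]
  show *: "integrable lborel (\<lambda>\<xi>. (1 + \<bar>\<xi>\<bar>) powr q * cmod (triple_char h k \<xi>))"
    by (rule integrableI_nonneg) (use bd in \<open>auto simp: le_less_trans\<close>)
  show "(LINT \<xi>|lborel. (1 + \<bar>\<xi>\<bar>) powr q * cmod (triple_char h k \<xi>)) \<le> triple_bound"
    using bd nn_integral_eq_integral[OF *] triple_bound_nonneg by (simp add: ennreal_le_iff)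
qed

lemma gaussian_le_powr: "exp (- (d * \<xi>)\<^sup>2 / 2) \<le> (1 + \<bar>\<xi>\<bar>) powr q"
proof -
  have "exp (- (d * \<xi>)\<^sup>2 / 2) \<le> 1" by simp
  also have "1 \<le> (1 + \<bar>\<xi>\<bar>) powr q" using q by (simp add: ge_one_powr_ge_zero)
  finally show ?thesis .
qed

text \<open>The Gaussian multiplier is at most 1, so the triple product alone gives a bound uniform
  in \<delta>. This controls the triples near the diagonal in \<open>form_small\<close>.\<close>

lemma unweighted_form_le:
  assumes "\<delta> > 0"
  shows "(LINT p|M3. exp (- (lin p / \<delta>)\<^sup>2 / 2) / \<delta>) \<le> triple_bound"
proof -
  have s: "1 \<le> sqrt (2 * pi)" using pi_gt3 by (simp add: real_le_rsqrt)
  have "complex_of_real (LINT p|M3. exp (- (lin p / \<delta>)\<^sup>2 / 2) / \<delta>)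
     = (CLINT p|M3. 1 * complex_of_real (exp (- (lin p / \<delta>)\<^sup>2 / 2) / \<delta>))"
    by (simp only: mult_1 integral_complex_of_real)
  also have "\<dots> = complex_of_real (1 / sqrt (2 * pi)) *
      (CLINT \<xi>|lborel. complex_of_real (exp (- (\<delta> * \<xi>)\<^sup>2 / 2)) * triple_char 0 0 \<xi>)"
    unfolding integral_iexp_lin[symmetric]
    by (rule M3.expectation_gaussian[of _ _ 1]) (use assms in auto)
  finally have eq: "complex_of_real (LINT p|M3. exp (- (lin p / \<delta>)\<^sup>2 / 2) / \<delta>) = \<dots>" .
  have "(LINT p|M3. exp (- (lin p / \<delta>)\<^sup>2 / 2) / \<delta>) \<le> cmod (complex_of_real (LINT p|M3. exp (- (lin p / \<delta>)\<^sup>2 / 2) / \<delta>))"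
    by (simp only: norm_of_real abs_ge_self)
  also have "\<dots> = 1 / sqrt (2 * pi) * cmod (CLINT \<xi>|lborel. complex_of_real (exp (- (\<delta> * \<xi>)\<^sup>2 / 2)) * triple_char 0 0 \<xi>)"
    unfolding eq norm_mult by (simp only: norm_of_real) simp
  also have "\<dots> \<le> 1 * cmod (CLINT \<xi>|lborel. complex_of_real (exp (- (\<delta> * \<xi>)\<^sup>2 / 2)) * triple_char 0 0 \<xi>)"
    using s by (intro mult_right_mono) auto
  also have "\<dots> \<le> (LINT \<xi>|lborel. (1 + \<bar>\<xi>\<bar>) powr q * cmod (triple_char 0 0 \<xi>))"
    unfolding mult_1
  proof (rule Bochner_Integration.integral_norm_bound_integral)
    have pt: "cmod (complex_of_real (exp (- (\<delta> * \<xi>)\<^sup>2 / 2)) * triple_char 0 0 \<xi>)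
      \<le> (1 + \<bar>\<xi>\<bar>) powr q * cmod (triple_char 0 0 \<xi>)" for \<xi>
    proof -
      have "exp (- (\<delta> * \<xi>)\<^sup>2 / 2) \<le> (1 + \<bar>\<xi>\<bar>) powr q"
        by (rule gaussian_le_powr)
      then show ?thesis by (simp add: norm_mult mult_right_mono)
    qed
    then show "\<And>\<xi>. \<xi> \<in> space lborel \<Longrightarrow> cmod (complex_of_real (exp (- (\<delta> * \<xi>)\<^sup>2 / 2)) * triple_char 0 0 \<xi>)
      \<le> (1 + \<bar>\<xi>\<bar>) powr q * cmod (triple_char 0 0 \<xi>)" .
    show "integrable lborel (\<lambda>\<xi>. (1 + \<bar>\<xi>\<bar>) powr q * cmod (triple_char 0 0 \<xi>))"
      by (rule powr_triple_char_integrable) auto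
    then show "integrable lborel (\<lambda>\<xi>. complex_of_real (exp (- (\<delta> * \<xi>)\<^sup>2 / 2)) * triple_char 0 0 \<xi>)"
      by (rule Bochner_Integration.integrable_bound) (use pt in \<open>auto intro: order.trans\<close>)
  qed
  also have "\<dots> \<le> triple_bound" by (rule powr_triple_char_integrable) auto
  finally show ?thesis .
qed

text \<open>On the frequency side the two forms differ by a difference of Gaussian multipliers,
  which is at most (\<delta> |\<xi>|)^q; the factor |\<xi>|^q is absorbed by
  \<open>nn_integral_triple_char\<close>. The constant 2 is 1 + (1 + 1) / 2, from the three
  characters in the weight.\<close>

lemma form_diff_le:
  assumes \<delta>: "0 < \<delta>'" "\<delta>' \<le> \<delta>"
  shows "form \<delta> \<le> form \<delta>' + 2 * triple_bound * \<delta> powr q"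
proof -
  have s: "1 \<le> sqrt (2 * pi)" using pi_gt3 by (simp add: real_le_rsqrt)
  \<comment> \<open>G is the Fourier side of the weighted integrand; H is its integrable majorant
    after multiplication by (1 + |\<xi>|)^q.\<close>
  define G where "G \<xi> = triple_char 0 0 \<xi> - (triple_char 1 (-1) \<xi> + triple_char (-1) 1 \<xi>) / 2" for \<xi>
  define H where "H \<xi> = (1 + \<bar>\<xi>\<bar>) powr q * cmod (triple_char 0 0 \<xi>)
    + ((1 + \<bar>\<xi>\<bar>) powr q * cmod (triple_char 1 (-1) \<xi>) + (1 + \<bar>\<xi>\<bar>) powr q * cmod (triple_char (-1) 1 \<xi>)) / 2" for \<xi>
  have [measurable]: "G \<in> borel_measurable borel" unfolding G_def by measurable
  have GH: "(1 + \<bar>\<xi>\<bar>) powr q * cmod (G \<xi>) \<le> H \<xi>" for \<xi>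
  proof -
    have "cmod (G \<xi>) \<le> cmod (triple_char 0 0 \<xi>) + cmod ((triple_char 1 (-1) \<xi> + triple_char (-1) 1 \<xi>) / 2)"
      unfolding G_def by (rule norm_triangle_ineq4)
    also have "cmod ((triple_char 1 (-1) \<xi> + triple_char (-1) 1 \<xi>) / 2) \<le> (cmod (triple_char 1 (-1) \<xi>) + cmod (triple_char (-1) 1 \<xi>)) / 2"
      using norm_triangle_ineq[of "triple_char 1 (-1) \<xi>" "triple_char (-1) 1 \<xi>"] by (simp add: norm_divide)
    finally have "(1 + \<bar>\<xi>\<bar>) powr q * cmod (G \<xi>) \<le> (1 + \<bar>\<xi>\<bar>) powr q * (cmod (triple_char 0 0 \<xi>) + (cmod (triple_char 1 (-1) \<xi>) + cmod (triple_char (-1) 1 \<xi>)) / 2)"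
      by (intro mult_left_mono) auto
    then show ?thesis by (simp add: H_def algebra_simps add_divide_distrib)
  qed
  have int: "integrable lborel (\<lambda>\<xi>. (1 + \<bar>\<xi>\<bar>) powr q * cmod (triple_char 0 0 \<xi>))"
    "integrable lborel (\<lambda>\<xi>. (1 + \<bar>\<xi>\<bar>) powr q * cmod (triple_char 1 (-1) \<xi>))"
    "integrable lborel (\<lambda>\<xi>. (1 + \<bar>\<xi>\<bar>) powr q * cmod (triple_char (-1) 1 \<xi>))"
    by (intro powr_triple_char_integrable; simp)+
  then have Hint: "integrable lborel H"
    unfolding H_def by (intro Bochner_Integration.integrable_add integrable_divide)
  have "(LINT \<xi>|lborel. H \<xi>) = (LINT \<xi>|lborel. (1 + \<bar>\<xi>\<bar>) powr q * cmod (triple_char 0 0 \<xi>))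
    + ((LINT \<xi>|lborel. (1 + \<bar>\<xi>\<bar>) powr q * cmod (triple_char 1 (-1) \<xi>)) + (LINT \<xi>|lborel. (1 + \<bar>\<xi>\<bar>) powr q * cmod (triple_char (-1) 1 \<xi>))) / 2"
    unfolding H_def
    by (simp only: Bochner_Integration.integral_add integral_divide_zero
        Bochner_Integration.integrable_add integrable_divide int)
  also have "\<dots> \<le> triple_bound + (triple_bound + triple_bound) / 2"
    by (intro add_mono divide_right_mono powr_triple_char_integrable) auto
  finally have Hbd: "(LINT \<xi>|lborel. H \<xi>) \<le> 2 * triple_bound" by simp
  have form_eq: "complex_of_real (form d) = complex_of_real (1 / sqrt (2 * pi)) *
      (CLINT \<xi>|lborel. complex_of_real (exp (- (d * \<xi>)\<^sup>2 / 2)) * G \<xi>)" if "d > 0" for d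
  proof -
    have "complex_of_real (form d) = (CLINT p|M3. complex_of_real (weight p) * complex_of_real (exp (- (lin p / d)\<^sup>2 / 2) / d))"
      by (simp only: form_def integral_complex_of_real flip: of_real_mult)
    also have "\<dots> = complex_of_real (1 / sqrt (2 * pi)) *
      (CLINT \<xi>|lborel. complex_of_real (exp (- (d * \<xi>)\<^sup>2 / 2)) * (CLINT p|M3. complex_of_real (weight p) * iexp (\<xi> * lin p)))"
      by (rule M3.expectation_gaussian[of _ _ 2]) (use weight_bounds that in auto)
    finally show ?thesis by (simp only: integral_weight_iexp_lin G_def)
  qed
  have int: "integrable lborel (\<lambda>\<xi>. complex_of_real (exp (- (d * \<xi>)\<^sup>2 / 2)) * G \<xi>)" for d
  proof (rule Bochner_Integration.integrable_bound[OF Hint])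
    show "AE \<xi> in lborel. cmod (complex_of_real (exp (- (d * \<xi>)\<^sup>2 / 2)) * G \<xi>) \<le> norm (H \<xi>)"
    proof (rule AE_I2)
      fix \<xi>
      have "exp (- (d * \<xi>)\<^sup>2 / 2) \<le> (1 + \<bar>\<xi>\<bar>) powr q"
        by (rule gaussian_le_powr)
      then have "exp (- (d * \<xi>)\<^sup>2 / 2) * cmod (G \<xi>) \<le> (1 + \<bar>\<xi>\<bar>) powr q * cmod (G \<xi>)"
        by (intro mult_right_mono) auto
      also note GH
      finally show "cmod (complex_of_real (exp (- (d * \<xi>)\<^sup>2 / 2)) * G \<xi>) \<le> norm (H \<xi>)"
        by (simp add: norm_mult)
    qed
  qed simp
  have "form \<delta> - form \<delta>' \<le> cmod (complex_of_real (form \<delta> - form \<delta>'))"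
    by (simp only: norm_of_real abs_ge_self)
  also have "complex_of_real (form \<delta> - form \<delta>') = complex_of_real (1 / sqrt (2 * pi)) *
      (CLINT \<xi>|lborel. complex_of_real (exp (- (\<delta> * \<xi>)\<^sup>2 / 2)) * G \<xi> - complex_of_real (exp (- (\<delta>' * \<xi>)\<^sup>2 / 2)) * G \<xi>)"
    unfolding of_real_diff form_eq[OF \<delta>(1)] form_eq[OF less_le_trans[OF \<delta>]] Bochner_Integration.integral_diff[OF int int]
      right_diff_distrib ..
  also have "cmod \<dots> \<le> 1 * cmod (CLINT \<xi>|lborel. complex_of_real (exp (- (\<delta> * \<xi>)\<^sup>2 / 2)) * G \<xi> - complex_of_real (exp (- (\<delta>' * \<xi>)\<^sup>2 / 2)) * G \<xi>)"
    unfolding norm_mult norm_of_real using s by (intro mult_right_mono) auto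
  also have "\<dots> \<le> (LINT \<xi>|lborel. \<delta> powr q * H \<xi>)"
    unfolding mult_1
  proof (rule Bochner_Integration.integral_norm_bound_integral)
    show "integrable lborel (\<lambda>\<xi>. complex_of_real (exp (- (\<delta> * \<xi>)\<^sup>2 / 2)) * G \<xi> - complex_of_real (exp (- (\<delta>' * \<xi>)\<^sup>2 / 2)) * G \<xi>)"
      by (intro Bochner_Integration.integrable_diff int)
    show "integrable lborel (\<lambda>\<xi>. \<delta> powr q * H \<xi>)"
      using Hint by simp
  next
    fix \<xi> :: real
    define v where "v = \<delta> * \<bar>\<xi>\<bar>"
    have v: "v \<ge> 0" using \<delta> by (simp add: v_def)
    have vq: "1 - exp (- v\<^sup>2 / 2) \<le> v powr q"
    proof (cases "v \<le> 1")
      case True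
      have "1 - exp (- v\<^sup>2 / 2) \<le> v\<^sup>2 / 2" using exp_ge_add_one_self[of "- v\<^sup>2 / 2"] by simp
      also have "\<dots> \<le> v" using v True mult_left_mono[of v 1 v] by (simp add: power2_eq_square)
      also have "\<dots> \<le> v powr q" using v True q powr_mono'[of q 1 v] by simp
      finally show ?thesis .
    next
      case False
      then have "1 \<le> v powr q" using q by (simp add: ge_one_powr_ge_zero)
      then show ?thesis using exp_ge_zero[of "- v\<^sup>2 / 2"] by linarith
    qed
    \<comment> \<open>The smaller width has the larger multiplier, and this is at most 1, so
      \<delta>' drops out of the bound.\<close>
    have "(\<delta>' * \<xi>)\<^sup>2 \<le> (\<delta> * \<xi>)\<^sup>2"
      unfolding power_mult_distrib using \<delta> by (intro mult_right_mono power_mono) auto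
    then have "\<bar>exp (- (\<delta> * \<xi>)\<^sup>2 / 2) - exp (- (\<delta>' * \<xi>)\<^sup>2 / 2)\<bar> = exp (- (\<delta>' * \<xi>)\<^sup>2 / 2) - exp (- (\<delta> * \<xi>)\<^sup>2 / 2)"
      by simp
    also have "\<dots> \<le> 1 - exp (- v\<^sup>2 / 2)"
      by (simp add: v_def power_mult_distrib)
    also have "\<dots> \<le> \<delta> powr q * \<bar>\<xi>\<bar> powr q" using vq \<delta> by (simp add: v_def powr_mult)
    also have "\<dots> \<le> \<delta> powr q * (1 + \<bar>\<xi>\<bar>) powr q" using q by (intro mult_left_mono powr_mono2) auto
    finally have e: "\<bar>exp (- (\<delta> * \<xi>)\<^sup>2 / 2) - exp (- (\<delta>' * \<xi>)\<^sup>2 / 2)\<bar> \<le> \<delta> powr q * (1 + \<bar>\<xi>\<bar>) powr q" .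
    have "cmod (complex_of_real (exp (- (\<delta> * \<xi>)\<^sup>2 / 2)) * G \<xi> - complex_of_real (exp (- (\<delta>' * \<xi>)\<^sup>2 / 2)) * G \<xi>)
      = \<bar>exp (- (\<delta> * \<xi>)\<^sup>2 / 2) - exp (- (\<delta>' * \<xi>)\<^sup>2 / 2)\<bar> * cmod (G \<xi>)"
      by (simp only: norm_mult norm_of_real flip: left_diff_distrib of_real_diff)
    also have "\<dots> \<le> (\<delta> powr q * (1 + \<bar>\<xi>\<bar>) powr q) * cmod (G \<xi>)"
      using e by (intro mult_right_mono) auto
    also have "\<dots> = \<delta> powr q * ((1 + \<bar>\<xi>\<bar>) powr q * cmod (G \<xi>))" by simp
    also have "\<dots> \<le> \<delta> powr q * H \<xi>" by (intro mult_left_mono GH) auto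
    finally show "cmod (complex_of_real (exp (- (\<delta> * \<xi>)\<^sup>2 / 2)) * G \<xi> - complex_of_real (exp (- (\<delta>' * \<xi>)\<^sup>2 / 2)) * G \<xi>) \<le> \<delta> powr q * H \<xi>" .
  qed
  also have "\<dots> = \<delta> powr q * (LINT \<xi>|lborel. H \<xi>)" by simp
  also have "\<dots> \<le> \<delta> powr q * (2 * triple_bound)" by (intro mult_left_mono Hbd) auto
  finally show ?thesis by (simp add: mult_ac)
qed

end

section \<open>Decay of the form in the absence of configurations\<close>

text \<open>Together with the next bound this makes \<open>weight\<close> comparable to (x - y)^2
  for |x - y| \<le> 2: the upper half disposes of triples near the diagonal, the lower half serves
  well-separated triples.\<close>

lemma one_minus_cos_le: "1 - cos t \<le> t\<^sup>2" for t :: real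
proof -
  have "1 - cos t = 2 * (sin (t / 2))\<^sup>2" using cos_double_sin[of "t / 2"] by simp
  also have "(sin (t / 2))\<^sup>2 \<le> (t / 2)\<^sup>2"
    using abs_sin_x_le_abs_x[of "t / 2"] by (simp only: abs_le_square_iff)
  finally have "1 - cos t \<le> t\<^sup>2 / 2" by (simp add: power_divide)
  then show ?thesis using zero_le_power2[of t] by linarith
qed

text \<open>For u = t / 2 in [-1, 1], sin u differs from u by at most |u| / 6, so |sin u| \<ge> |u|
  / 2; the half-angle formula does the rest.\<close>

lemma one_minus_cos_ge: "t\<^sup>2 / 8 \<le> 1 - cos t" if "\<bar>t\<bar> \<le> 2" for t :: real
proof -
  define u where "u = t / 2"
  have u: "\<bar>u\<bar> \<le> 1" using that by (simp add: u_def)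
  have "\<bar>sin u - u\<bar> \<le> \<bar>u\<bar> ^ 3 / 6"
    using Maclaurin_sin_bound[of u 3] by (simp add: sin_coeff_def eval_nat_numeral)
  also have "\<bar>u\<bar> ^ 3 \<le> \<bar>u\<bar> ^ 1" using u by (intro power_decreasing) auto
  finally have "\<bar>u / 2\<bar> \<le> \<bar>sin u\<bar>" by (simp add: abs_if split: if_splits)
  then have "(u / 2)\<^sup>2 \<le> (sin u)\<^sup>2" by (simp only: abs_le_square_iff)
  moreover have "1 - cos t = 2 * (sin u)\<^sup>2" using cos_double_sin[of u] by (simp add: u_def)
  ultimately show ?thesis by (simp add: u_def power_divide)
qed

context decaying_pattern
begin

text \<open>Triples with |x - y| < \<tau> have weight at most \<tau>^2 and are controlled by
  \<open>unweighted_form_le\<close>. The remaining triples of A form a compact set on which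
  \<open>lin\<close> has no zero, so |\<open>lin\<close>| is bounded below there and the kernel
  tends to 0 with its width.\<close>

lemma form_small:
  assumes A: "compact A" "AE x in M. x \<in> A"
    and nondeg: "\<And>x y z. x \<in> A \<Longrightarrow> y \<in> A \<Longrightarrow> z \<in> A \<Longrightarrow> a * x + b * y + c * z = 0 \<Longrightarrow> x = y"
    and "\<eta> > 0" "\<delta> > 0"
  obtains \<delta>' where "0 < \<delta>'" "\<delta>' \<le> \<delta>" "form \<delta>' \<le> \<eta>"
proof -
  interpret P: pair_prob_space M M ..
  interpret Q: pair_prob_space M "M \<Otimes>\<^sub>M M" ..
  have [measurable]: "A \<in> sets M" using A(1) by (simp add: borel_compact)
  have AE: "AE p in M3. fst p \<in> A \<and> fst (snd p) \<in> A \<and> snd (snd p) \<in> A"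
  proof (rule Q.AE_pair_measure, measurable)
    have *: "AE p in M \<Otimes>\<^sub>M M. fst p \<in> A \<and> snd p \<in> A"
    proof (rule P.AE_pair_measure, measurable)
      show "AE x in M. AE y in M. fst (x, y) \<in> A \<and> snd (x, y) \<in> A"
        using A(2) by eventually_elim (use A(2) in auto)
    qed
    show "AE x in M. AE y in M \<Otimes>\<^sub>M M. fst (x, y) \<in> A \<and> fst (snd (x, y)) \<in> A \<and> snd (snd (x, y)) \<in> A"
      using A(2) by eventually_elim (use * in auto)
  qed
  \<comment> \<open>Chosen so that \<tau>^2 times \<open>triple_bound\<close> is at most \<eta> / 2;
    the + 1 covers \<open>triple_bound = 0\<close>.\<close>
  define \<tau> where "\<tau> = sqrt (\<eta> / (2 * (triple_bound + 1)))"
  have \<tau>: "\<tau> > 0" "\<tau>\<^sup>2 * triple_bound \<le> \<eta> / 2"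
    using triple_bound_nonneg \<open>\<eta> > 0\<close> by (auto simp: \<tau>_def field_simps)
  define S where "S = (A \<times> A \<times> A) \<inter> {p. \<tau> \<le> \<bar>fst p - fst (snd p)\<bar>}"
  have "closed {p :: real \<times> real \<times> real. \<tau> \<le> \<bar>fst p - fst (snd p)\<bar>}"
    by (intro closed_Collect_le continuous_intros)
  then have S: "compact S"
    unfolding S_def by (intro compact_Int_closed compact_Times A)
  obtain m where m: "m > 0" "\<And>p. p \<in> S \<Longrightarrow> m \<le> \<bar>lin p\<bar>"
  proof (cases "S = {}")
    case False
    have "continuous_on S (\<lambda>p. \<bar>lin p\<bar>)" unfolding lin_def by (intro continuous_intros)
    from continuous_attains_inf[OF S False this] obtain p0
      where p0: "p0 \<in> S" "\<And>p. p \<in> S \<Longrightarrow> \<bar>lin p0\<bar> \<le> \<bar>lin p\<bar>" by blast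
    have "lin p0 \<noteq> 0"
      using p0(1) nondeg[of "fst p0" "fst (snd p0)" "snd (snd p0)"] \<tau>
      by (auto simp: S_def lin_def)
    then show ?thesis using that[of "\<bar>lin p0\<bar>"] p0 by auto
  qed (use that[of 1] in auto)
  \<comment> \<open>On S the bound exp (-v) \<le> 1 / v makes the integrand at most 4 \<delta>' /
    m^2, which is at most \<eta> / 2 by this choice.\<close>
  define \<delta>' where "\<delta>' = min \<delta> (\<eta> * m\<^sup>2 / 8)"
  have \<delta>': "\<delta>' > 0" "\<delta>' \<le> \<delta>" "\<delta>' \<le> \<eta> * m\<^sup>2 / 8"
    using \<open>\<delta> > 0\<close> \<open>\<eta> > 0\<close> m by (auto simp: \<delta>'_def)
  let ?g = "\<lambda>p. exp (- (lin p / \<delta>')\<^sup>2 / 2) / \<delta>'"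
  have int: "integrable M3 ?g"
    by (rule M3.integrable_const_bound[of _ "1 / \<delta>'"]) (use \<delta>' in \<open>auto simp: divide_right_mono\<close>)
  have "integrable M3 (\<lambda>p. weight p * ?g p)"
  proof (rule M3.integrable_const_bound[of _ "2 * (1 / \<delta>')"])
    show "AE p in M3. norm (weight p * ?g p) \<le> 2 * (1 / \<delta>')"
      unfolding norm_mult
      by (intro AE_I2 mult_mono) (use \<delta>' weight_bounds in \<open>auto simp: divide_right_mono\<close>)
  qed measurable
  then have "form \<delta>' \<le> (LINT p|M3. \<tau>\<^sup>2 * ?g p + \<eta> / 2)"
    unfolding form_def
  proof (rule integral_mono_AE)
    show "integrable M3 (\<lambda>p. \<tau>\<^sup>2 * ?g p + \<eta> / 2)"
      by (intro Bochner_Integration.integrable_add integrable_mult_right int) simp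
    show "AE p in M3. weight p * ?g p \<le> \<tau>\<^sup>2 * ?g p + \<eta> / 2"
      using AE
    proof eventually_elim
      case (elim p)
      show ?case
      proof (cases "p \<in> S")
        case True
        define v where "v = (lin p / \<delta>')\<^sup>2 / 2"
        have mv: "m\<^sup>2 / (2 * \<delta>'\<^sup>2) \<le> v"
          using power_mono[OF m(2)[OF True], of 2] m(1) \<delta>'(1)
          by (simp add: v_def power_divide field_simps)
        have "0 < m\<^sup>2 / (2 * \<delta>'\<^sup>2)" using m(1) \<delta>'(1) by simp
        then have "1 / exp v \<le> 1 / (m\<^sup>2 / (2 * \<delta>'\<^sup>2))"
          using mv exp_ge_add_one_self[of v] by (intro frac_le) linarith+
        then have ev: "exp (- v) \<le> 2 * \<delta>'\<^sup>2 / m\<^sup>2" by (simp add: exp_minus field_simps)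
        have "weight p * ?g p \<le> 2 * (exp (- v) / \<delta>')"
          unfolding v_def using weight_bounds[of p] \<delta>'(1) by (intro mult_mono) auto
        also have "\<dots> \<le> 2 * ((2 * \<delta>'\<^sup>2 / m\<^sup>2) / \<delta>')"
          using ev \<delta>'(1) by (intro mult_left_mono divide_right_mono) auto
        also have "\<dots> = 4 * \<delta>' / m\<^sup>2" using \<delta>'(1) by (simp add: power2_eq_square)
        also have "\<dots> \<le> \<eta> / 2" using \<delta>'(3) m(1) by (simp add: field_simps)
        also have "\<dots> \<le> \<tau>\<^sup>2 * ?g p + \<eta> / 2" using \<delta>'(1) by simp
        finally show ?thesis .
      next
        case False
        with elim have "\<bar>fst p - fst (snd p)\<bar> \<le> \<bar>\<tau>\<bar>" by (cases p) (auto simp: S_def)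
        then have "(fst p - fst (snd p))\<^sup>2 \<le> \<tau>\<^sup>2" by (simp only: abs_le_square_iff)
        then have "weight p \<le> \<tau>\<^sup>2"
          using one_minus_cos_le[of "fst p - fst (snd p)"] by (simp add: weight_def)
        then have "weight p * ?g p \<le> \<tau>\<^sup>2 * ?g p" using \<delta>'(1) by (intro mult_right_mono) auto
        then show ?thesis using \<open>\<eta> > 0\<close> by linarith
      qed
    qed
  qed
  also have "\<dots> = \<tau>\<^sup>2 * (LINT p|M3. ?g p) + \<eta> / 2"
  proof -
    have "(LINT p|M3. \<tau>\<^sup>2 * ?g p + \<eta> / 2) = (LINT p|M3. \<tau>\<^sup>2 * ?g p) + (LINT p|M3. \<eta> / 2)"
      by (intro Bochner_Integration.integral_add integrable_mult_right int) simp
    also have "(LINT p|M3. \<tau>\<^sup>2 * ?g p) = \<tau>\<^sup>2 * (LINT p|M3. ?g p)"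
      by (rule integral_mult_right_zero)
    also have "(LINT p|M3. \<eta> / 2) = \<eta> / 2" by (simp add: M3.prob_space)
    finally show ?thesis .
  qed
  also have "\<dots> \<le> \<tau>\<^sup>2 * triple_bound + \<eta> / 2"
    using unweighted_form_le[OF \<delta>'(1)] by (intro add_right_mono mult_left_mono) auto
  also have "\<dots> \<le> \<eta>" using \<tau> by simp
  finally show ?thesis using that \<delta>' by blast
qed

text \<open>\<open>form_small\<close> supplies arbitrarily small values at finer widths, and
  \<open>form_diff_le\<close> carries them back to \<delta> with an error independent of the finer
  width.\<close>

lemma form_le:
  assumes A: "compact A" "AE x in M. x \<in> A"
    and nondeg: "\<And>x y z. x \<in> A \<Longrightarrow> y \<in> A \<Longrightarrow> z \<in> A \<Longrightarrow> a * x + b * y + c * z = 0 \<Longrightarrow> x = y"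
    and "\<delta> > 0"
  shows "form \<delta> \<le> 2 * triple_bound * \<delta> powr q"
proof (rule field_le_epsilon)
  fix \<eta> :: real assume "\<eta> > 0"
  obtain \<delta>' where "0 < \<delta>'" "\<delta>' \<le> \<delta>" "form \<delta>' \<le> \<eta>"
    by (rule form_small[OF A nondeg \<open>\<eta> > 0\<close> \<open>\<delta> > 0\<close>])
  then show "form \<delta> \<le> 2 * triple_bound * \<delta> powr q + \<eta>"
    using form_diff_le[of \<delta>' \<delta>] by linarith
qed

end

section \<open>Counting configurations of cells\<close>

text \<open>Telescoping: the factors U are replaced by x, y, z one at a time, and each replacement
  costs at most U^2 times the corresponding deficit.\<close>

lemma cube_diff_le:
  fixes U x y z :: real
  assumes "0 \<le> x" "x \<le> U" "0 \<le> y" "y \<le> U" "0 \<le> z" "z \<le> U"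
  shows "U ^ 3 - x * (y * z) \<le> U\<^sup>2 * ((U - x) + (U - y) + (U - z))"
proof -
  have "x * U * (U - y) \<le> U * U * (U - y)" using assms by (intro mult_right_mono) auto
  moreover have "x * y * (U - z) \<le> U * U * (U - z)" using assms by (intro mult_right_mono mult_mono) auto
  moreover have "U ^ 3 - x * (y * z) = U * U * (U - x) + x * U * (U - y) + x * y * (U - z)"
    by (simp add: algebra_simps power3_eq_cube)
  moreover have "U\<^sup>2 * ((U - x) + (U - y) + (U - z)) = U * U * (U - x) + U * U * (U - y) + U * U * (U - z)"
    by (simp add: algebra_simps power2_eq_square)
  ultimately show ?thesis by linarith
qed

text \<open>The total deficit D below the cap U is at most 8 P L U / 12. For each of the L steps u,
  the middle half of the indices stays in range under both shifts, and by
  \<open>cube_diff_le\<close> its sum falls short of 4 P L U^3 by at most 3 U^2 D \<le> 2 P L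
  U^3.\<close>

lemma pattern_count_ge:
  fixes m :: "int \<Rightarrow> real" and P L p\<^sub>1 p\<^sub>2 :: int and U :: real
  assumes m: "\<And>k. 0 \<le> k \<Longrightarrow> k < 8 * P * L \<Longrightarrow> 0 \<le> m k \<and> m k \<le> U"
    and mass: "(\<Sum>k\<in>{0..<8 * P * L}. m k) \<ge> 11 / 12 * (8 * P * L * U)"
    and P: "P \<ge> 1" "\<bar>p\<^sub>1\<bar> \<le> P" "\<bar>p\<^sub>2\<bar> \<le> P" and L: "L \<ge> 1"
  shows "(\<Sum>u\<in>{L..<2 * L}. \<Sum>i\<in>{2 * P * L..<6 * P * L}. m i * (m (i - p\<^sub>1 * u) * m (i - p\<^sub>2 * u)))
    \<ge> 2 * P * L\<^sup>2 * U ^ 3"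
proof -
  define N where "N = 8 * P * L"
  define I where "I = {2 * P * L..<6 * P * L}"
  have PL: "P * L > 0" using P L by simp
  have U: "U \<ge> 0" using m[of 0] PL by (simp add: mult.assoc)
  define D where "D = (\<Sum>k\<in>{0..<N}. U - m k)"
  have card: "real (nat (8 * P * L)) = 8 * P * L" using PL by (simp add: mult.assoc)
  have D: "D \<le> 8 * P * L * U / 12"
    using mass card by (simp add: D_def N_def sum_subtractf)
  have range: "0 \<le> i - p * u \<and> i - p * u < N" if "i \<in> I" "L \<le> u" "u < 2 * L" "\<bar>p\<bar> \<le> P" for i p u
  proof -
    have "\<bar>p * u\<bar> \<le> P * (2 * L)"
      unfolding abs_mult using that L by (intro mult_mono) auto
    then show ?thesis using that(1) by (auto simp: I_def N_def)
  qed
  \<comment> \<open>The translate of I lies inside the full range, where every deficit is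
    non-negative.\<close>
  have shift: "(\<Sum>i\<in>I. U - m (i - p * u)) \<le> D" if u: "L \<le> u" "u < 2 * L" and p: "\<bar>p\<bar> \<le> P" for u p
  proof -
    have "(\<Sum>i\<in>I. U - m (i - p * u)) = (\<Sum>k\<in>(\<lambda>i. i - p * u) ` I. U - m k)"
      by (subst sum.reindex) (auto simp: inj_on_def)
    also have "\<dots> \<le> D"
      unfolding D_def by (intro sum_mono2) (use range u p m in \<open>auto simp: N_def\<close>)
    finally show ?thesis .
  qed
  have inner: "4 * P * L * U ^ 3 - 3 * U\<^sup>2 * D \<le> (\<Sum>i\<in>I. m i * (m (i - p\<^sub>1 * u) * m (i - p\<^sub>2 * u)))"
    if u: "L \<le> u" "u < 2 * L" for u
  proof -
    \<comment> \<open>The first deficit is written with shift 0 so that \<open>range\<close> and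
      \<open>shift\<close> treat all three alike.\<close>
    have "(\<Sum>i\<in>I. U ^ 3 - m i * (m (i - p\<^sub>1 * u) * m (i - p\<^sub>2 * u)))
       \<le> (\<Sum>i\<in>I. U\<^sup>2 * ((U - m (i - 0 * u)) + (U - m (i - p\<^sub>1 * u)) + (U - m (i - p\<^sub>2 * u))))"
    proof (intro sum_mono)
      fix i assume "i \<in> I"
      note r = range[OF this u]
      show "U ^ 3 - m i * (m (i - p\<^sub>1 * u) * m (i - p\<^sub>2 * u)) \<le> U\<^sup>2 * ((U - m (i - 0 * u)) + (U - m (i - p\<^sub>1 * u)) + (U - m (i - p\<^sub>2 * u)))"
        using cube_diff_le[of "m i" U "m (i - p\<^sub>1 * u)" "m (i - p\<^sub>2 * u)"]
          m[of i] m[of "i - p\<^sub>1 * u"] m[of "i - p\<^sub>2 * u"] r[of 0] r[of p\<^sub>1] r[of p\<^sub>2] P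
        by (simp add: N_def)
    qed
    also have "\<dots> = U\<^sup>2 * ((\<Sum>i\<in>I. U - m (i - 0 * u)) + (\<Sum>i\<in>I. U - m (i - p\<^sub>1 * u)) + (\<Sum>i\<in>I. U - m (i - p\<^sub>2 * u)))"
      by (simp only: sum.distrib flip: sum_distrib_left)
    also have "\<dots> \<le> U\<^sup>2 * (D + D + D)"
      using P by (intro mult_left_mono add_mono shift u) auto
    finally have "(\<Sum>i\<in>I. U ^ 3 - m i * (m (i - p\<^sub>1 * u) * m (i - p\<^sub>2 * u))) \<le> 3 * U\<^sup>2 * D" by simp
    moreover have "real (card I) = 4 * P * L"
      using PL by (simp add: I_def mult.commute)
    ultimately show ?thesis by (simp add: sum_subtractf)
  qed
  have "3 * U\<^sup>2 * D \<le> 3 * U\<^sup>2 * (8 * P * L * U / 12)" using D by (intro mult_left_mono) auto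
  also have "\<dots> = 2 * P * L * U ^ 3" by (simp add: power2_eq_square power3_eq_cube)
  finally have "L * (2 * P * L * U ^ 3) \<le> L * (4 * P * L * U ^ 3 - 3 * U\<^sup>2 * D)"
    by (intro mult_left_mono) (linarith, use L in simp)
  also have "\<dots> = (\<Sum>u\<in>{L..<2 * L}. 4 * P * L * U ^ 3 - 3 * U\<^sup>2 * D)" using L by simp
  also have "\<dots> \<le> (\<Sum>u\<in>{L..<2 * L}. \<Sum>i\<in>I. m i * (m (i - p\<^sub>1 * u) * m (i - p\<^sub>2 * u)))"
    by (intro sum_mono inner) auto
  finally show ?thesis by (simp add: I_def power2_eq_square mult_ac)
qed

subsection \<open>Lower bound from near-uniform cells\<close>

text \<open>Half-open, so that consecutive cells tile without overlap and the index of a point is a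
  floor.\<close>

definition cell :: "real \<Rightarrow> real \<Rightarrow> int \<Rightarrow> real set" where
  "cell e \<delta> k = {e + k * \<delta> ..< e + (k + 1) * \<delta>}"

lemma cell_borel [measurable]: "cell e \<delta> k \<in> sets borel"
  by (simp add: cell_def)

lemma cell_unique:
  assumes "x \<in> cell e \<delta> i" "x \<in> cell e \<delta> j" "\<delta> > 0"
  shows "i = j"
proof -
  have "k = \<lfloor>(x - e) / \<delta>\<rfloor>" if "x \<in> cell e \<delta> k" for k
    using that \<open>\<delta> > 0\<close> by (intro floor_unique[symmetric]) (auto simp: cell_def field_simps)
  then show ?thesis using assms by metis
qed

lemma Un_cells:
  assumes "\<delta> > 0" "n \<ge> 0"
  shows "(\<Union>k\<in>{0..<n}. cell e \<delta> k) = {e ..< e + n * \<delta>}"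
proof (intro equalityI subsetI)
  fix x assume "x \<in> (\<Union>k\<in>{0..<n}. cell e \<delta> k)"
  then obtain k where k: "0 \<le> k" "k + 1 \<le> n" "x \<in> cell e \<delta> k" by auto
  have "0 \<le> k * \<delta>" "real_of_int (k + 1) * \<delta> \<le> n * \<delta>"
    using k assms by (intro mult_nonneg_nonneg mult_right_mono; simp)+
  then show "x \<in> {e ..< e + n * \<delta>}" using k(3) by (auto simp: cell_def)
next
  fix x assume x: "x \<in> {e ..< e + n * \<delta>}"
  define k where "k = \<lfloor>(x - e) / \<delta>\<rfloor>"
  have "k \<le> (x - e) / \<delta>" "(x - e) / \<delta> < k + 1"
    unfolding k_def by linarith+
  then have "x \<in> cell e \<delta> k"
    using assms by (simp add: cell_def pos_le_divide_eq pos_divide_less_eq)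
  moreover have "0 \<le> k" "k < n"
    using x assms by (auto simp: k_def floor_less_iff field_simps)
  ultimately show "x \<in> (\<Union>k\<in>{0..<n}. cell e \<delta> k)" by auto
qed

lemma (in real_distribution) sum_measure_cells:
  assumes "\<delta> > 0" "n \<ge> 0"
  shows "(\<Sum>k\<in>{0..<n}. measure M (cell e \<delta> k)) = measure M {e ..< e + n * \<delta>}"
  unfolding Un_cells[OF assms, symmetric]
  by (intro finite_measure_finite_Union[symmetric])
    (use cell_unique[OF _ _ assms(1)] in \<open>auto simp: disjoint_family_on_def\<close>)

context linear_pattern
begin

lemma measure_M3_Times:
  assumes [measurable]: "X \<in> sets borel" "Y \<in> sets borel" "Z \<in> sets borel"
  shows "measure M3 (X \<times> (Y \<times> Z)) = measure M X * (measure M Y * measure M Z)"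
proof -
  interpret P: pair_prob_space M M ..
  have "emeasure M3 (X \<times> (Y \<times> Z)) = emeasure M X * (emeasure M Y * emeasure M Z)"
    by (subst P.emeasure_pair_measure_Times, measurable, subst emeasure_pair_measure_Times) auto
  then show ?thesis by (simp add: measure_def enn2real_mult)
qed

text \<open>The integrand is at least \<kappa> on every box of three cells with indices i, i - p1 u,
  i - p2 u; the boxes are disjoint, and \<open>pattern_count_ge\<close> bounds their total mass from
  below. The result depends on the scale only through L \<delta>, a fixed fraction of the length of
  the interval.\<close>

lemma form_ge:
  fixes p\<^sub>1 p\<^sub>2 P L :: int and e \<delta> D :: real
  assumes abc: "a = p\<^sub>2 - p\<^sub>1" "b = - p\<^sub>2" "c = p\<^sub>1"
    and P: "\<bar>p\<^sub>1\<bar> \<le> P" "\<bar>p\<^sub>2\<bar> \<le> P" and L: "L \<ge> 2"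
    and \<delta>: "\<delta> > 0" "8 * P * L * \<delta> \<le> 2" and D: "D \<ge> 0"
    and mass: "measure M {e ..< e + 8 * P * L * \<delta>} \<ge> D * (8 * P * L * \<delta>)"
    and cells: "\<And>k. measure M (cell e \<delta> k) \<le> 13 / 12 * D * \<delta>"
  shows "form \<delta> \<ge> exp (- 8 * P\<^sup>2) * D ^ 3 * (L * \<delta>) ^ 4 / 16"
proof -
  have p1: "p\<^sub>1 \<noteq> 0" "\<bar>p\<^sub>1\<bar> \<ge> 1" using coeffs abc by auto
  then have P1: "P \<ge> 1" using P by linarith
  define U where "U = 13 / 12 * D * \<delta>"
  have U: "D * \<delta> \<le> U" "0 \<le> U" using D \<delta> by (auto simp: U_def)
  define S where "S = {L..<2 * L} \<times> {2 * P * L..<6 * P * L}"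
  define R where "R = (\<lambda>(u, i). cell e \<delta> i \<times> (cell e \<delta> (i - p\<^sub>1 * u) \<times> cell e \<delta> (i - p\<^sub>2 * u)))"
  \<comment> \<open>The first factor bounds the weight when |x - y| \<ge> L \<delta> / 2, the second
    the kernel when |\<open>lin p\<close>| \<le> 4 P \<delta>.\<close>
  define \<kappa> where "\<kappa> = (L * \<delta>)\<^sup>2 / 32 * (exp (- 8 * P\<^sup>2) / \<delta>)"
  have \<kappa>: "\<kappa> \<ge> 0" using \<delta> by (simp add: \<kappa>_def)
  have R_sets [measurable]: "R s \<in> sets M3" for s
    unfolding R_def split_beta by (intro pair_measureI) auto
  have intR: "integrable M3 (indicat_real (R s))" for s
    by (rule integrable_real_indicator[OF R_sets]) (simp add: M3.emeasure_eq_measure)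
  \<comment> \<open>The first two cells determine i and i - p1 u, hence also u because p1 is
    non-zero; so the boxes are disjoint.\<close>
  have unique: "s = t" if "p \<in> R s" "p \<in> R t" for p s t
  proof -
    obtain u i v j where st: "s = (u, i)" "t = (v, j)" by (cases s, cases t) auto
    have "i = j" "i - p\<^sub>1 * u = j - p\<^sub>1 * v"
      using that by (auto simp: st R_def intro: cell_unique[OF _ _ \<delta>(1)])
    then show ?thesis using p1 by (simp add: st)
  qed
  have on_R: "\<kappa> \<le> weight p * (exp (- (lin p / \<delta>)\<^sup>2 / 2) / \<delta>)" if s: "s \<in> S" "p \<in> R s" for p s
  proof -
    obtain u i where ui: "s = (u, i)" by (cases s) auto
    obtain x y z where p: "p = (x, y, z)" by (cases p) auto
    have u: "L \<le> u" "u < 2 * L" and i: "2 * P * L \<le> i" "i < 6 * P * L"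
      using s by (auto simp: S_def ui)
    define x' where "x' = x - e - i * \<delta>"
    define y' where "y' = y - e - (i - p\<^sub>1 * u) * \<delta>"
    define z' where "z' = z - e - (i - p\<^sub>2 * u) * \<delta>"
    have bds: "0 \<le> x'" "x' \<le> \<delta>" "0 \<le> y'" "y' \<le> \<delta>" "0 \<le> z'" "z' \<le> \<delta>"
      using s(2) by (auto simp: p ui R_def cell_def x'_def y'_def z'_def algebra_simps)
    have "lin p = a * x + b * y + c * z"
      by (simp add: p lin_def)
    \<comment> \<open>The left endpoints of the cells form an exact configuration: a + b + c = 0 and
      b p1 + c p2 = 0, so only the offsets inside the cells remain.\<close>
    also have "\<dots> = a * x' + b * y' + c * z'"
      by (simp add: x'_def y'_def z'_def abc algebra_simps)
    also have "\<bar>\<dots>\<bar> \<le> \<bar>a\<bar> * \<bar>x'\<bar> + \<bar>b\<bar> * \<bar>y'\<bar> + \<bar>c\<bar> * \<bar>z'\<bar>"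
      unfolding abs_mult[symmetric] by linarith
    also have "\<dots> \<le> (2 * P) * \<delta> + P * \<delta> + P * \<delta>"
      using P bds abc by (intro add_mono mult_mono) auto
    finally have "\<bar>lin p / \<delta>\<bar> \<le> \<bar>4 * real_of_int P\<bar>" using \<delta> P1 by (simp add: abs_div field_simps)
    then have "(lin p / \<delta>)\<^sup>2 \<le> (4 * real_of_int P)\<^sup>2" by (simp only: abs_le_square_iff)
    then have ex: "exp (- 8 * P\<^sup>2) \<le> exp (- (lin p / \<delta>)\<^sup>2 / 2)" by (simp add: power_mult_distrib)
    have xy: "x - y = (x' - y') + p\<^sub>1 * u * \<delta>"
      by (simp add: x'_def y'_def algebra_simps)
    have "1 * u \<le> \<bar>p\<^sub>1\<bar> * u" using p1 u L by (intro mult_right_mono) auto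
    then have "real_of_int L \<le> \<bar>p\<^sub>1\<bar> * u" using u by linarith
    then have "L * \<delta> \<le> \<bar>p\<^sub>1\<bar> * u * \<delta>" using \<delta> by (intro mult_right_mono) auto
    also have "\<dots> = \<bar>p\<^sub>1 * u * \<delta>\<bar>" using u L \<delta> by (simp add: abs_mult)
    finally have "L * \<delta> - \<delta> \<le> \<bar>x - y\<bar>" unfolding xy using bds by linarith
    \<comment> \<open>L \<ge> 2 ensures that the offset error \<delta> is at most half of the
      separation L \<delta>.\<close>
    moreover have "2 * \<delta> \<le> L * \<delta>" using L \<delta> by (intro mult_right_mono) auto
    ultimately have lo: "L * \<delta> / 2 \<le> \<bar>x - y\<bar>" by linarith
    have pu: "\<bar>p\<^sub>1 * u\<bar> \<le> P * (2 * L)"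
      unfolding abs_mult using u L P by (intro mult_mono) auto
    \<comment> \<open>This keeps |x - y| \<le> 2, the range in which \<open>one_minus_cos_ge\<close>
      applies.\<close>
    have "\<bar>p\<^sub>1 * u\<bar> + 1 \<le> 8 * P * L" using pu P1 L mult_mono[of 1 P 1 L] by simp
    then have "(real_of_int \<bar>p\<^sub>1 * u\<bar> + 1) * \<delta> \<le> (8 * P * L) * \<delta>"
      using \<delta> by (intro mult_right_mono) linarith+
    moreover have "real_of_int \<bar>p\<^sub>1 * u\<bar> * \<delta> = \<bar>p\<^sub>1 * u * \<delta>\<bar>" using \<delta> by (simp add: abs_mult)
    ultimately have "\<bar>p\<^sub>1 * u * \<delta>\<bar> + \<delta> \<le> 2" using \<delta>(2) by (simp add: algebra_simps)
    then have hi: "\<bar>x - y\<bar> \<le> 2" unfolding xy using bds by linarith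
    have "(L * \<delta> / 2)\<^sup>2 \<le> \<bar>x - y\<bar>\<^sup>2" using lo L \<delta> by (intro power_mono) auto
    then have "(L * \<delta>)\<^sup>2 / 32 \<le> (x - y)\<^sup>2 / 8" by (simp add: power_divide)
    also have "\<dots> \<le> weight p" using one_minus_cos_ge[OF hi] by (simp add: weight_def p)
    finally show ?thesis
      unfolding \<kappa>_def using ex \<delta> by (intro mult_mono divide_right_mono) (auto simp: weight_bounds)
  qed
  have "2 * P * L\<^sup>2 * U ^ 3 \<le> (\<Sum>u\<in>{L..<2 * L}. \<Sum>i\<in>{2 * P * L..<6 * P * L}.
      measure M (cell e \<delta> i) * (measure M (cell e \<delta> (i - p\<^sub>1 * u)) * measure M (cell e \<delta> (i - p\<^sub>2 * u))))"
  proof (rule pattern_count_ge)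
    have PL: "0 \<le> 8 * P * L" using P1 L by simp
    \<comment> \<open>The cap 13/12 on the cells fits the fraction 11/12 because 11/12 * 13/12 =
      143/144 < 1.\<close>
    have "11 / 12 * (8 * P * L * U) \<le> D * (8 * P * L * \<delta>)"
      using D \<delta> P1 L by (simp add: U_def)
    also note mass
    also have "measure M {e ..< e + 8 * P * L * \<delta>} = (\<Sum>k\<in>{0..<8 * P * L}. measure M (cell e \<delta> k))"
      using sum_measure_cells[OF \<delta>(1) PL, of e] by simp
    finally show "11 / 12 * (8 * P * L * U) \<le> (\<Sum>k\<in>{0..<8 * P * L}. measure M (cell e \<delta> k))" .
  qed (use cells P P1 L in \<open>auto simp: U_def\<close>)
  also have "\<dots> = (\<Sum>s\<in>S. measure M3 (R s))"
    by (simp add: S_def R_def sum.cartesian_product measure_M3_Times split_beta)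
  also have "\<dots> = (LINT p|M3. (\<Sum>s\<in>S. indicator (R s) p))"
    by (simp add: Bochner_Integration.integral_sum intR space_pair_measure)
  finally have "\<kappa> * (2 * P * L\<^sup>2 * U ^ 3) \<le> \<kappa> * (LINT p|M3. (\<Sum>s\<in>S. indicator (R s) p))"
    using \<kappa> by (rule mult_left_mono)
  also have "\<dots> = (LINT p|M3. \<kappa> * (\<Sum>s\<in>S. indicator (R s) p))" by simp
  also have "\<dots> \<le> form \<delta>"
    unfolding form_def
  proof (rule integral_mono)
    show "integrable M3 (\<lambda>p. \<kappa> * (\<Sum>s\<in>S. indicator (R s) p))"
      by (intro integrable_mult_right Bochner_Integration.integrable_sum intR)
    show "integrable M3 (\<lambda>p. weight p * (exp (- (lin p / \<delta>)\<^sup>2 / 2) / \<delta>))"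
    proof (rule M3.integrable_const_bound[of _ "2 * (1 / \<delta>)"])
      show "AE p in M3. norm (weight p * (exp (- (lin p / \<delta>)\<^sup>2 / 2) / \<delta>)) \<le> 2 * (1 / \<delta>)"
        unfolding norm_mult
        by (intro AE_I2 mult_mono) (use \<delta> weight_bounds in \<open>auto simp: divide_right_mono\<close>)
    qed measurable
    fix p
    show "\<kappa> * (\<Sum>s\<in>S. indicator (R s) p) \<le> weight p * (exp (- (lin p / \<delta>)\<^sup>2 / 2) / \<delta>)"
    proof (cases "\<exists>s\<in>S. p \<in> R s")
      case True
      then obtain s where s: "s \<in> S" "p \<in> R s" by blast
      have "(\<Sum>t\<in>S. indicator (R t) p) = (\<Sum>t\<in>S. if t = s then 1 else 0 :: real)"
      proof (intro sum.cong refl)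
        fix t
        show "indicator (R t) p = (if t = s then 1 else 0 :: real)"
          using unique[OF s(2), of t] s(2) by (cases "p \<in> R t") auto
      qed
      also have "\<dots> = 1" using s by (simp add: S_def)
      finally show ?thesis using on_R[OF s] by simp
    next
      case False
      then have "(\<Sum>t\<in>S. indicator (R t) p) = (0::real)" by (intro sum.neutral) auto
      then show ?thesis using weight_bounds[of p] \<delta> by simp
    qed
  qed
  finally have form: "\<kappa> * (2 * P * L\<^sup>2 * U ^ 3) \<le> form \<delta>" .
  have "(D * \<delta>) ^ 3 \<le> U ^ 3" using U D \<delta> by (intro power_mono) auto
  then have "1 * (L\<^sup>2 * (D * \<delta>) ^ 3) \<le> P * (L\<^sup>2 * U ^ 3)"
    using P1 D \<delta> by (intro mult_mono) auto
  then have "\<kappa> * (2 * (1 * (L\<^sup>2 * (D * \<delta>) ^ 3))) \<le> \<kappa> * (2 * (P * (L\<^sup>2 * U ^ 3)))"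
    using \<kappa> by (intro mult_left_mono) auto
  moreover have "\<kappa> * (2 * (1 * (L\<^sup>2 * (D * \<delta>) ^ 3))) = exp (- 8 * P\<^sup>2) * D ^ 3 * (L * \<delta>) ^ 4 / 16"
    using \<delta> by (simp add: \<kappa>_def power_mult_distrib power2_eq_square power3_eq_cube power4_eq_xxxx)
  moreover have "\<kappa> * (2 * (P * (L\<^sup>2 * U ^ 3))) \<le> form \<delta>"
    using form by (simp add: mult.assoc)
  ultimately show ?thesis by linarith
qed

end

subsection \<open>Density increment\<close>

text \<open>The complement of the support is a union of open null sets, and Lindelof's theorem
  reduces it to a countable one.\<close>

lemma (in real_distribution) AE_in_support:
  assumes "msupport M \<subseteq> A"
  shows "AE x in M. x \<in> A"
proof -
  define F where "F = {U. open U \<and> emeasure M U = 0}"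
  obtain F' where F': "F' \<subseteq> F" "countable F'" "\<Union>F' = \<Union>F"
    using Lindelof[of F] by (auto simp: F_def)
  have "(\<Union>U\<in>F'. U) \<in> null_sets M"
    using F' by (intro null_sets_UN') (auto simp: F_def null_sets_def)
  then have "\<Union>F \<in> null_sets M" using F'(3) by simp
  then have "AE x in M. x \<notin> \<Union>F" by (rule AE_not_in)
  moreover have "x \<in> A" if "x \<notin> \<Union>F" for x
    using that assms by (auto simp: F_def msupport_def zero_less_iff_neq_zero)
  ultimately show ?thesis by (rule eventually_mono)
qed

lemma scale_exists:
  fixes T q \<rho> c :: real and P :: int
  assumes "T \<ge> 0" "q > 0" "\<rho> > 0" "c > 0" "P \<ge> 1"
  obtains L :: int where "L \<ge> 2" "2 * T * (\<rho> / (8 * P * L)) powr q < c"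
proof -
  \<comment> \<open>h solves 2 (T + 1) h^q = c; T + 1 in place of T makes the final inequality
    strict and allows T = 0.\<close>
  define h where "h = (c / (2 * (T + 1))) powr (1 / q)"
  have h: "h > 0" using assms by (simp add: h_def)
  obtain n :: nat where n: "\<rho> / h < n" using reals_Archimedean2 by blast
  define L where "L = int n + 2"
  have L: "L \<ge> 2" "\<rho> < h * L" using n h by (auto simp: L_def field_simps)
  have "h * L * 1 \<le> h * L * (8 * P)" using h L assms by (intro mult_left_mono) auto
  then have "\<rho> / (8 * P * L) \<le> h" using L assms by (simp add: field_simps)
  then have "(\<rho> / (8 * P * L)) powr q \<le> h powr q"
    using assms L by (intro powr_mono2) auto
  also have "\<dots> = c / (2 * (T + 1))" using assms by (simp add: h_def powr_powr)
  finally have "2 * T * (\<rho> / (8 * P * L)) powr q \<le> 2 * T * (c / (2 * (T + 1)))"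
    using assms by (intro mult_left_mono) auto
  also have "\<dots> < c" using assms by (simp add: field_simps)
  finally show ?thesis using that L by blast
qed

text \<open>The length \<rho> is quantified before M and A; this uniformity lets the threshold for
  the exponent be fixed before the measure is known. In the induction step, \<open>form_ge\<close>
  and \<open>form_le\<close> contradict each other at a suitable smaller scale unless some interval
  of that length has density larger by the factor 13/12.\<close>

lemma density_increment:
  fixes p\<^sub>1 p\<^sub>2 :: int and q K B :: real
  assumes "0 < q" "q \<le> 1" "K \<ge> 0"
  defines "a \<equiv> real_of_int (p\<^sub>2 - p\<^sub>1)" and "b \<equiv> - real_of_int p\<^sub>2" and "c \<equiv> real_of_int p\<^sub>1"
  shows "\<exists>\<rho>>0. \<rho> \<le> 2 \<and> (\<forall>M A. decaying_pattern M a b c q K B \<and> compact A \<and> A \<subseteq> {0..1} \<and> (AE x in M. x \<in> A) \<and>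
      (\<forall>x\<in>A. \<forall>y\<in>A. \<forall>z\<in>A. a * x + b * y + c * z = 0 \<longrightarrow> x = y)
      \<longrightarrow> (\<exists>e. (13 / 12) ^ j / 2 * \<rho> \<le> measure M {e ..< e + \<rho>}))"
proof (induction j)
  case 0
  \<comment> \<open>Length 2 lets the half-open interval contain the endpoint 1 of the unit
    interval; the starting density is therefore 1/2.\<close>
  have "measure M {0 ..< 0 + 2 :: real} = 1"
    if "decaying_pattern M a b c q K B" "A \<subseteq> {0..1}" "AE x in M. x \<in> A" for M A
  proof -
    interpret decaying_pattern M a b c q K B by fact
    have "AE x in M. x \<in> {0 ..< 0 + 2 :: real}"
      using that(3) by eventually_elim (use that(2) in auto)
    then show ?thesis by (subst prob_eq_1) auto
  qed
  then show ?case by (intro exI[of _ 2]) (auto intro!: exI[of _ 0])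
next
  case (Suc j)
  then obtain \<rho> where \<rho>: "0 < \<rho>" "\<rho> \<le> 2" and IH: "\<And>M A. decaying_pattern M a b c q K B \<Longrightarrow> compact A \<Longrightarrow> A \<subseteq> {0..1} \<Longrightarrow> (AE x in M. x \<in> A) \<Longrightarrow>
      (\<forall>x\<in>A. \<forall>y\<in>A. \<forall>z\<in>A. a * x + b * y + c * z = 0 \<longrightarrow> x = y)
      \<Longrightarrow> (\<exists>e. (13 / 12) ^ j / 2 * \<rho> \<le> measure M {e ..< e + \<rho>})"
    by blast
  define D :: real where "D = (13 / 12) ^ j / 2"
  have D: "D > 0" by (simp add: D_def)
  define P :: int where "P = max 1 (max \<bar>p\<^sub>1\<bar> \<bar>p\<^sub>2\<bar>)"
  have P: "P \<ge> 1" "\<bar>p\<^sub>1\<bar> \<le> P" "\<bar>p\<^sub>2\<bar> \<le> P" by (auto simp: P_def)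
  \<comment> \<open>This is \<open>triple_bound\<close> with |B| for B: here no measure is given yet
    from whose decay B \<ge> 0 would follow.\<close>
  define T where "T = \<bar>B\<bar> * K * (4 + \<bar>a\<bar> + \<bar>b\<bar>)"
  have "T \<ge> 0" using \<open>K \<ge> 0\<close> by (simp add: T_def)
  moreover have "exp (- 8 * P\<^sup>2) * D ^ 3 * (\<rho> / (8 * P)) ^ 4 / 16 > 0" using D \<rho> P by simp
  \<comment> \<open>L \<delta> = \<rho> / (8 P) does not depend on L, so the lower bound of
    \<open>form_ge\<close> stays fixed while the upper bound of \<open>form_le\<close> tends to 0 as
    L grows.\<close>
  ultimately obtain L :: int where L: "L \<ge> 2"
      "2 * T * (\<rho> / (8 * P * L)) powr q < exp (- 8 * P\<^sup>2) * D ^ 3 * (\<rho> / (8 * P)) ^ 4 / 16"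
    using scale_exists[OF _ \<open>0 < q\<close> \<open>0 < \<rho>\<close> _ P(1)] by metis
  define \<delta> where "\<delta> = \<rho> / (8 * P * L)"
  have PL: "1 \<le> P * L" using mult_mono[of 1 P 1 L] P L by simp
  then have PL': "1 \<le> real_of_int P * L" by (metis of_int_1_le_iff of_int_mult)
  have \<delta>: "\<delta> > 0" using \<rho> P L by (simp add: \<delta>_def)
  have \<rho>\<delta>: "8 * P * L * \<delta> = \<rho>" using P L by (simp add: \<delta>_def)
  have L\<delta>: "L * \<delta> = \<rho> / (8 * P)" using P L by (simp add: \<delta>_def)
  have "1 * \<delta> \<le> (8 * (real_of_int P * L)) * \<delta>" using PL' \<delta> by (intro mult_right_mono) auto
  then have \<delta>2: "\<delta> \<le> 2" using \<rho>\<delta> \<rho> by (simp add: mult.assoc)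
  have "\<exists>e. (13 / 12) ^ Suc j / 2 * \<delta> \<le> measure M {e ..< e + \<delta>}"
    if M: "decaying_pattern M a b c q K B"
      and A: "compact A" "A \<subseteq> {0..1}" "AE x in M. x \<in> A"
      and nondeg: "\<forall>x\<in>A. \<forall>y\<in>A. \<forall>z\<in>A. a * x + b * y + c * z = 0 \<longrightarrow> x = y" for M A
  proof (rule ccontr)
    assume no: "\<nexists>e. (13 / 12) ^ Suc j / 2 * \<delta> \<le> measure M {e ..< e + \<delta>}"
    interpret decaying_pattern M a b c q K B by fact
    have T: "triple_bound = T" using B_nonneg by (simp add: triple_bound_def T_def)
    obtain e where e: "D * \<rho> \<le> measure M {e ..< e + \<rho>}"
      using IH[OF M A nondeg] by (auto simp: D_def)
    \<comment> \<open>Each cell is itself an interval of length \<delta>, so the absence of an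
      increment caps all cells at once.\<close>
    have cell: "measure M (cell e \<delta> k) \<le> 13 / 12 * D * \<delta>" for k
    proof -
      have "\<not> (13 / 12) ^ Suc j / 2 * \<delta> \<le> measure M {e + k * \<delta> ..< (e + k * \<delta>) + \<delta>}"
        using no by blast
      then show ?thesis by (simp add: cell_def D_def algebra_simps)
    qed
    have "exp (- 8 * P\<^sup>2) * D ^ 3 * (L * \<delta>) ^ 4 / 16 \<le> form \<delta>"
    proof (rule form_ge[where e = e and p\<^sub>1 = p\<^sub>1 and p\<^sub>2 = p\<^sub>2 and P = P])
      show "D * (8 * P * L * \<delta>) \<le> measure M {e ..< e + 8 * P * L * \<delta>}"
        using e unfolding \<rho>\<delta> .
      show "8 * P * L * \<delta> \<le> 2" unfolding \<rho>\<delta> by (rule \<rho>(2))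
    qed (use P L \<delta> D cell in \<open>auto simp: a_def b_def c_def\<close>)
    also have "form \<delta> \<le> 2 * T * \<delta> powr q"
      unfolding T[symmetric] by (rule form_le[OF A(1,3) _ \<delta>]) (use nondeg in blast)
    finally show False using L(2) unfolding \<delta>_def[symmetric] L\<delta> by linarith
  qed
  with \<delta> \<delta>2 show ?case by (intro exI[of _ \<delta>]) blast
qed

section \<open>Choice of the parameters and passage to rational coefficients\<close>

text \<open>For |\<xi>| \<ge> 1 this is the hypothesis at frequency -\<xi> / (2 pi), whence the
  factor (2 pi)^s; for |\<xi>| < 1, where |\<xi>|^-s can be large, the trivial bound by 1 suffices.
  The exponent is written as -2 q with q = min s 1 / 4, the shape required by
  \<open>decay\<close>.\<close>

lemma char_decay:
  fixes C s :: real
  assumes "real_distribution M" "C \<ge> 0" "s > 0"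
    and ft: "\<And>\<xi>. \<xi> \<noteq> 0 \<Longrightarrow> (cmod (fourier_transform M \<xi>))\<^sup>2 \<le> C * \<bar>\<xi>\<bar> powr - s"
  shows "cmod (char M \<xi>) \<le> sqrt (2 * (C * (2 * pi) powr s + 1)) * (1 + \<bar>\<xi>\<bar>) powr (- 2 * (min s 1 / 4))"
proof (rule power2_le_imp_le)
  interpret real_distribution M by fact
  define s' where "s' = min s 1"
  have s': "0 < s'" "s' \<le> 1" "s' \<le> s" using \<open>s > 0\<close> by (auto simp: s'_def)
  have "(cmod (char M \<xi>))\<^sup>2 \<le> (C * (2 * pi) powr s + 1) * (2 * (1 + \<bar>\<xi>\<bar>) powr - s')"
  proof (cases "1 \<le> \<bar>\<xi>\<bar>")
    case True
    have "fourier_transform M (- \<xi> / (2 * pi)) = char M \<xi>"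
      unfolding fourier_transform_def char_def
      by (intro Bochner_Integration.integral_cong refl arg_cong[of _ _ exp]) (simp add: field_simps)
    then have "(cmod (char M \<xi>))\<^sup>2 \<le> C * \<bar>- \<xi> / (2 * pi)\<bar> powr - s"
      using ft[of "- \<xi> / (2 * pi)"] True by auto
    also have "\<bar>- \<xi> / (2 * pi)\<bar> powr - s = (2 * pi) powr s * \<bar>\<xi>\<bar> powr - s"
      using pi_gt_zero by (simp add: powr_divide powr_minus field_simps)
    also have "\<bar>\<xi>\<bar> powr - s \<le> \<bar>\<xi>\<bar> powr - s'" using s' True by (intro powr_mono) auto
    also have "\<dots> \<le> ((1 + \<bar>\<xi>\<bar>) / 2) powr - s'" using s' True by (intro powr_mono2') auto
    also have "\<dots> = 2 powr s' * (1 + \<bar>\<xi>\<bar>) powr - s'" by (simp add: powr_divide powr_minus field_simps)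
    also have "\<dots> \<le> 2 powr 1 * (1 + \<bar>\<xi>\<bar>) powr - s'" using s' by (intro mult_right_mono powr_mono) auto
    finally have "(cmod (char M \<xi>))\<^sup>2 \<le> C * ((2 * pi) powr s * (2 * (1 + \<bar>\<xi>\<bar>) powr - s'))"
      using \<open>C \<ge> 0\<close> by (simp add: mult_left_mono)
    also have "\<dots> \<le> (C * (2 * pi) powr s + 1) * (2 * (1 + \<bar>\<xi>\<bar>) powr - s')"
      by (simp add: algebra_simps)
    finally show ?thesis .
  next
    case False
    have "(cmod (char M \<xi>))\<^sup>2 \<le> 1" by (intro power_le_one cmod_char_le_1 norm_ge_zero)
    also have "(1::real) = 2 * 2 powr - 1" by (simp add: powr_minus)
    also have "\<dots> \<le> 2 * 2 powr - s'" using s' by (intro mult_left_mono powr_mono) auto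
    also have "\<dots> \<le> 2 * (1 + \<bar>\<xi>\<bar>) powr - s'" using s' False by (intro mult_left_mono powr_mono2') auto
    also have "\<dots> \<le> (C * (2 * pi) powr s + 1) * (2 * (1 + \<bar>\<xi>\<bar>) powr - s')"
      using \<open>C \<ge> 0\<close> by (simp add: algebra_simps)
    finally show ?thesis .
  qed
  also have "(1 + \<bar>\<xi>\<bar>) powr - s' = ((1 + \<bar>\<xi>\<bar>) powr (- 2 * (min s 1 / 4)))\<^sup>2"
    by (simp add: s'_def power2_eq_square flip: powr_add)
  also have "(C * (2 * pi) powr s + 1) * (2 * ((1 + \<bar>\<xi>\<bar>) powr (- 2 * (min s 1 / 4)))\<^sup>2)
     = (sqrt (2 * (C * (2 * pi) powr s + 1)))\<^sup>2 * ((1 + \<bar>\<xi>\<bar>) powr (- 2 * (min s 1 / 4)))\<^sup>2"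
    using \<open>C \<ge> 0\<close> by (subst real_sqrt_pow2) (simp, simp only: mult_ac)
  finally show "(cmod (char M \<xi>))\<^sup>2 \<le> (sqrt (2 * (C * (2 * pi) powr s + 1)) * (1 + \<bar>\<xi>\<bar>) powr (- 2 * (min s 1 / 4)))\<^sup>2"
    by (simp only: power_mult_distrib)
qed (use \<open>C \<ge> 0\<close> in simp)

text \<open>A counterexample would satisfy the hypotheses of \<open>density_increment\<close>, and
  the J-th interval obtained there is too dense for the ball condition.\<close>

lemma integer_pattern:
  fixes p\<^sub>1 p\<^sub>2 :: int and C\<^sub>1 C\<^sub>2 s :: real
  assumes p: "p\<^sub>1 \<noteq> 0" "p\<^sub>2 \<noteq> 0" "p\<^sub>1 \<noteq> p\<^sub>2"
    and C: "C\<^sub>1 > 0" "C\<^sub>2 > 0" "s > 0"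
  shows "\<exists>\<epsilon>\<^sub>s>0. \<forall>(A::real set) (\<mu>::real measure).
    A \<subseteq> {0..1} \<and> compact A \<and> supports_measure A \<mu> \<and>
    (\<forall>\<xi>. \<xi> \<noteq> 0 \<longrightarrow> (cmod (fourier_transform \<mu> \<xi>))\<^sup>2 \<le> C\<^sub>1 * \<bar>\<xi>\<bar> powr (- s)) \<and>
    (\<exists>\<epsilon>\<^sub>0. 0 < \<epsilon>\<^sub>0 \<and> \<epsilon>\<^sub>0 \<le> \<epsilon>\<^sub>s \<and>
      (\<forall>x r. r > 0 \<longrightarrow> measure \<mu> (ball x r) \<le> C\<^sub>2 * r powr (1 - \<epsilon>\<^sub>0)))
    \<longrightarrow> (\<exists>x u :: real. u \<noteq> 0 \<and> {x, x - p\<^sub>1 * u, x - p\<^sub>2 * u} \<subseteq> A)"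
proof -
  define q where "q = min s 1 / 4"
  have q: "0 < q" "q \<le> 1" using C by (auto simp: q_def)
  define K where "K = 64 * sqrt (2 * pi) * C\<^sub>2 / (1 - 2 powr (- q / 2))"
  have "2 powr (- q / 2) \<le> (2::real) powr 0" using q by (intro powr_mono) auto
  then have K: "K \<ge> 0" using C by (simp add: K_def)
  define B where "B = sqrt (2 * (C\<^sub>1 * (2 * pi) powr s + 1))"
  \<comment> \<open>After J increments the density (13/12)^J / 2 exceeds 2
    \<open>C\<^sub>2\<close>.\<close>
  obtain J where J: "4 * C\<^sub>2 < (13 / 12 :: real) ^ J"
    using real_arch_pow[of "13 / 12" "4 * C\<^sub>2"] by auto
  define a where "a = real_of_int (p\<^sub>2 - p\<^sub>1)"
  define b where "b = - real_of_int p\<^sub>2"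
  define c where "c = real_of_int p\<^sub>1"
  obtain \<rho> where \<rho>: "0 < \<rho>" and incr: "\<And>M A. decaying_pattern M a b c q K B \<Longrightarrow> compact A \<Longrightarrow> A \<subseteq> {0..1} \<Longrightarrow> (AE x in M. x \<in> A) \<Longrightarrow>
      (\<forall>x\<in>A. \<forall>y\<in>A. \<forall>z\<in>A. a * x + b * y + c * z = 0 \<longrightarrow> x = y)
      \<Longrightarrow> (\<exists>e. (13 / 12) ^ J / 2 * \<rho> \<le> measure M {e ..< e + \<rho>})"
    using density_increment[OF q K, where B = B and j = J and p\<^sub>1 = p\<^sub>1 and p\<^sub>2 = p\<^sub>2]
    unfolding a_def b_def c_def by blast
  \<comment> \<open>The first term makes \<open>nn_integral_char_weighted\<close> applicable; the
    second ensures \<rho>^-\<epsilon> \<le> 2, with + 1 guarding against \<rho> = 1.\<close>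
  define \<epsilon>\<^sub>s where "\<epsilon>\<^sub>s = min (q / 2) (ln 2 / (\<bar>ln \<rho>\<bar> + 1))"
  have \<epsilon>\<^sub>s: "\<epsilon>\<^sub>s > 0" using q by (simp add: \<epsilon>\<^sub>s_def add_nonneg_pos)
  have main: "\<exists>x u :: real. u \<noteq> 0 \<and> {x, x - p\<^sub>1 * u, x - p\<^sub>2 * u} \<subseteq> A"
    if A: "A \<subseteq> {0..1}" "compact A" "supports_measure A \<mu>"
      and ft: "\<forall>\<xi>. \<xi> \<noteq> 0 \<longrightarrow> (cmod (fourier_transform \<mu> \<xi>))\<^sup>2 \<le> C\<^sub>1 * \<bar>\<xi>\<bar> powr (- s)"
      and \<epsilon>: "0 < \<epsilon>" "\<epsilon> \<le> \<epsilon>\<^sub>s"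
      and ball: "\<forall>x r. r > 0 \<longrightarrow> measure \<mu> (ball x r) \<le> C\<^sub>2 * r powr (1 - \<epsilon>)" for A \<mu> \<epsilon>
  proof (rule ccontr)
    assume no: "\<nexists>x u :: real. u \<noteq> 0 \<and> {x, x - p\<^sub>1 * u, x - p\<^sub>2 * u} \<subseteq> A"
    interpret real_distribution \<mu> using A(3) by (simp add: supports_measure_def)
    have "1 \<le> \<bar>p\<^sub>2 - p\<^sub>1\<bar>" "1 \<le> \<bar>p\<^sub>1\<bar>" "1 \<le> \<bar>p\<^sub>2\<bar>" using p by linarith+
    then have lp: "linear_pattern \<mu> a b c"
      by unfold_locales (auto simp: a_def b_def c_def simp flip: of_int_abs of_int_diff)
    have dp: "decaying_pattern \<mu> a b c q K B"
      unfolding decaying_pattern_def decaying_pattern_axioms_def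
    proof (intro conjI lp q K allI)
      show "(\<integral>\<^sup>+\<xi>. ennreal ((1 + \<bar>\<xi>\<bar>) powr - q * (cmod (char \<mu> \<xi>))\<^sup>2) \<partial>lborel) \<le> ennreal K"
        unfolding K_def
        by (rule nn_integral_char_weighted[OF ball[rule_format] q]) (use \<epsilon> in \<open>auto simp: \<epsilon>\<^sub>s_def\<close>)
      show "cmod (char \<mu> \<xi>) \<le> B * (1 + \<bar>\<xi>\<bar>) powr (- 2 * q)" for \<xi>
        unfolding B_def q_def
        by (rule char_decay) (use C ft real_distribution_axioms in auto)
    qed
    have AE: "AE x in \<mu>. x \<in> A"
      using A(3) by (intro AE_in_support) (simp add: supports_measure_def)
    have nondeg: "\<forall>x\<in>A. \<forall>y\<in>A. \<forall>z\<in>A. a * x + b * y + c * z = 0 \<longrightarrow> x = y"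
    proof (intro ballI impI, rule ccontr)
      fix x y z assume xyz: "x \<in> A" "y \<in> A" "z \<in> A" and eq: "a * x + b * y + c * z = 0" and "x \<noteq> y"
      \<comment> \<open>This choice gives y = x - p1 u at once, and the linear relation then forces
        z = x - p2 u.\<close>
      define u where "u = (x - y) / p\<^sub>1"
      have pu: "p\<^sub>1 * u = x - y" using p by (simp add: u_def)
      then have y: "x - p\<^sub>1 * u = y" by simp
      have "p\<^sub>1 * (x - p\<^sub>2 * u) = p\<^sub>1 * x - p\<^sub>2 * (x - y)"
        unfolding pu[symmetric] by (simp add: algebra_simps)
      then have "p\<^sub>1 * (x - p\<^sub>2 * u) = p\<^sub>1 * z"
        using eq by (simp add: a_def b_def c_def algebra_simps)
      then have z: "x - p\<^sub>2 * u = z" using p by simp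
      have "u \<noteq> 0" using \<open>x \<noteq> y\<close> p by (simp add: u_def)
      then have "u \<noteq> 0 \<and> {x, x - p\<^sub>1 * u, x - p\<^sub>2 * u} \<subseteq> A"
        using xyz by (simp add: y z)
      then show False using no by (elim notE) (intro exI)
    qed
    obtain e where e: "(13 / 12) ^ J / 2 * \<rho> \<le> measure \<mu> {e ..< e + \<rho>}"
      using incr[OF dp A(2,1) AE nondeg] by (elim exE)
    \<comment> \<open>Centring the ball at the endpoint e gives it radius exactly \<rho>, so the
      ball condition is read at the scale \<rho> itself.\<close>
    have "measure \<mu> {e ..< e + \<rho>} \<le> measure \<mu> (ball e \<rho>)"
      by (rule finite_measure_mono) (auto simp: dist_real_def)
    also have "\<dots> \<le> C\<^sub>2 * \<rho> powr (1 - \<epsilon>)" using ball \<rho> by simp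
    also have "\<rho> powr (1 - \<epsilon>) = \<rho> * \<rho> powr - \<epsilon>"
      using \<rho> powr_add[of \<rho> 1 "- \<epsilon>"] by simp
    also have "\<rho> powr - \<epsilon> \<le> 2"
    proof -
      have "- \<epsilon> * ln \<rho> \<le> \<epsilon> * (\<bar>ln \<rho>\<bar> + 1)"
        using mult_left_mono[of "- ln \<rho>" "\<bar>ln \<rho>\<bar> + 1" \<epsilon>] \<epsilon> by simp
      also have "\<epsilon> \<le> ln 2 / (\<bar>ln \<rho>\<bar> + 1)" using \<epsilon> by (simp add: \<epsilon>\<^sub>s_def)
      then have "\<epsilon> * (\<bar>ln \<rho>\<bar> + 1) \<le> ln 2" by (simp add: pos_le_divide_eq add_nonneg_pos)
      finally have "exp (- \<epsilon> * ln \<rho>) \<le> exp (ln 2)" by (simp only: exp_le_cancel_iff)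
      then show ?thesis using \<rho> by (simp add: powr_def)
    qed
    finally have "measure \<mu> {e ..< e + \<rho>} \<le> 2 * C\<^sub>2 * \<rho>"
      using C \<rho> by (simp add: mult_left_mono)
    moreover have "2 * C\<^sub>2 * \<rho> < (13 / 12) ^ J / 2 * \<rho>"
      using J \<rho> by (intro mult_strict_right_mono) auto
    ultimately show False using e by linarith
  qed
  show ?thesis
    by (rule exI[of _ \<epsilon>\<^sub>s], intro conjI allI impI \<epsilon>\<^sub>s, elim conjE exE, rule main)
qed

lemma rational_common_denominator:
  fixes x y :: real
  assumes "x \<in> \<rat>" "y \<in> \<rat>"
  obtains d m n :: int where "d \<noteq> 0" "x * d = m" "y * d = n"
proof -
  obtain k l :: int where kl: "l \<noteq> 0" "x = k / l"
    using assms(1) by (auto simp: Rats_eq_int_div_int)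
  obtain k' l' :: int where kl': "l' \<noteq> 0" "y = k' / l'"
    using assms(2) by (auto simp: Rats_eq_int_div_int)
  show ?thesis
    by (rule that[of "l * l'" "k * l'" "k' * l"]) (use kl kl' in auto)
qed

text \<open>Lets the conclusion be replaced under the quantifiers while the hypotheses on the set
  and the measure stay untouched.\<close>

lemma ex_pos_mono:
  fixes P :: "real \<Rightarrow> 'a \<Rightarrow> 'b \<Rightarrow> bool"
  assumes "\<exists>\<epsilon>>0. \<forall>x y. P \<epsilon> x y \<longrightarrow> Q x" and "\<And>x. Q x \<Longrightarrow> R x"
  shows "\<exists>\<epsilon>>0. \<forall>x y. P \<epsilon> x y \<longrightarrow> R x"
  using assms by blast

lemma distinct_rational_pattern:
  fixes \<gamma>\<^sub>1 \<gamma>\<^sub>2 C\<^sub>1 C\<^sub>2 s :: real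
  assumes \<gamma>: "\<gamma>\<^sub>1 \<in> \<rat>" "\<gamma>\<^sub>1 \<noteq> 0" "\<gamma>\<^sub>2 \<in> \<rat>" "\<gamma>\<^sub>2 \<noteq> 0" "\<gamma>\<^sub>1 \<noteq> \<gamma>\<^sub>2"
    and C: "C\<^sub>1 > 0" "C\<^sub>2 > 0" "s > 0"
  shows "\<exists>\<epsilon>\<^sub>s>0. \<forall>(A::real set) (\<mu>::real measure).
    A \<subseteq> {0..1} \<and> compact A \<and> supports_measure A \<mu> \<and>
    (\<forall>\<xi>. \<xi> \<noteq> 0 \<longrightarrow> (cmod (fourier_transform \<mu> \<xi>))\<^sup>2 \<le> C\<^sub>1 * \<bar>\<xi>\<bar> powr (- s)) \<and>
    (\<exists>\<epsilon>\<^sub>0. 0 < \<epsilon>\<^sub>0 \<and> \<epsilon>\<^sub>0 \<le> \<epsilon>\<^sub>s \<and>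
      (\<forall>x r. r > 0 \<longrightarrow> measure \<mu> (ball x r) \<le> C\<^sub>2 * r powr (1 - \<epsilon>\<^sub>0)))
    \<longrightarrow> (\<exists>x t. t \<noteq> 0 \<and> {x, x - \<gamma>\<^sub>1 * t, x - \<gamma>\<^sub>2 * t} \<subseteq> A)"
proof -
  obtain d m n :: int where d: "d \<noteq> 0" "\<gamma>\<^sub>1 * d = m" "\<gamma>\<^sub>2 * d = n"
    using rational_common_denominator[OF \<gamma>(1,3)] .
  have "real_of_int m \<noteq> 0" "real_of_int n \<noteq> 0" "real_of_int m \<noteq> real_of_int n"
    using \<gamma> d(1) unfolding d(2,3)[symmetric] by auto
  then have mn: "m \<noteq> 0" "n \<noteq> 0" "m \<noteq> n" by auto
  \<comment> \<open>The witness is t = d u, since multiplying it by \<open>\<gamma>\<^sub>1\<close>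
    or \<open>\<gamma>\<^sub>2\<close> gives m u or n u.\<close>
  have *: "\<exists>t. t \<noteq> 0 \<and> {x, x - \<gamma>\<^sub>1 * t, x - \<gamma>\<^sub>2 * t} \<subseteq> A"
    if "u \<noteq> 0" "{x, x - m * u, x - n * u} \<subseteq> A" for A :: "real set" and x u :: real
    using that d(1) unfolding d(2,3)[symmetric]
    by (intro exI[of _ "d * u"]) (simp add: mult.assoc)
  show ?thesis
  proof (rule ex_pos_mono[OF integer_pattern[OF mn C]])
    fix A :: "real set"
    assume "\<exists>x u :: real. u \<noteq> 0 \<and> {x, x - m * u, x - n * u} \<subseteq> A"
    then obtain x u :: real where "u \<noteq> 0" "{x, x - m * u, x - n * u} \<subseteq> A"
      by (elim exE conjE)
    from *[OF this] show "\<exists>x t. t \<noteq> 0 \<and> {x, x - \<gamma>\<^sub>1 * t, x - \<gamma>\<^sub>2 * t} \<subseteq> A"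
      by (rule exI)
  qed
qed

theorem theorem1p10:
  fixes \<gamma>\<^sub>1 \<gamma>\<^sub>2 C\<^sub>1 C\<^sub>2 s :: real
  assumes "\<gamma>\<^sub>1 \<in> \<rat>" "\<gamma>\<^sub>1 \<noteq> 0" "\<gamma>\<^sub>2 \<in> \<rat>" "\<gamma>\<^sub>2 \<noteq> 0"
    and "C\<^sub>1 > 0" "C\<^sub>2 > 0" "s > 0"
  shows "\<exists>\<epsilon>\<^sub>s>0. \<forall>(A::real set) (\<mu>::real measure).
    A \<subseteq> {0..1} \<and> compact A \<and> supports_measure A \<mu> \<and>
    (\<forall>\<xi>. \<xi> \<noteq> 0 \<longrightarrow> (cmod (fourier_transform \<mu> \<xi>))\<^sup>2 \<le> C\<^sub>1 * \<bar>\<xi>\<bar> powr (- s)) \<and>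
    (\<exists>\<epsilon>\<^sub>0. 0 < \<epsilon>\<^sub>0 \<and> \<epsilon>\<^sub>0 \<le> \<epsilon>\<^sub>s \<and>
      (\<forall>x r. r > 0 \<longrightarrow> measure \<mu> (ball x r) \<le> C\<^sub>2 * r powr (1 - \<epsilon>\<^sub>0)))
    \<longrightarrow> (\<exists>x t. t \<noteq> 0 \<and> {x, x - \<gamma>\<^sub>1 * t, x - \<gamma>\<^sub>2 * t} \<subseteq> A)"
proof (cases "\<gamma>\<^sub>1 = \<gamma>\<^sub>2")
  case False
  then show ?thesis by (intro distinct_rational_pattern assms)
next
  case True
  \<comment> \<open>The configuration for \<open>\<gamma>\<^sub>1\<close> and
    \<open>2 * \<gamma>\<^sub>1\<close> contains x and \<open>x - \<gamma>\<^sub>1 * t\<close>,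
    which is the whole set required when the two coefficients coincide.\<close>
  have *: "\<exists>t. t \<noteq> 0 \<and> {x, x - \<gamma>\<^sub>1 * t, x - \<gamma>\<^sub>2 * t} \<subseteq> A"
    if "t \<noteq> 0" "{x, x - \<gamma>\<^sub>1 * t, x - (2 * \<gamma>\<^sub>1) * t} \<subseteq> A" for A :: "real set" and x t :: real
    using that True by auto
  have "2 * \<gamma>\<^sub>1 \<in> \<rat>" "2 * \<gamma>\<^sub>1 \<noteq> 0" "\<gamma>\<^sub>1 \<noteq> 2 * \<gamma>\<^sub>1"
    using assms by auto
  from distinct_rational_pattern[OF assms(1,2) this assms(5-7)] show ?thesis
  proof (rule ex_pos_mono)
    fix A :: "real set"
    assume "\<exists>x t. t \<noteq> 0 \<and> {x, x - \<gamma>\<^sub>1 * t, x - (2 * \<gamma>\<^sub>1) * t} \<subseteq> A"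
    then obtain x t where "t \<noteq> 0" "{x, x - \<gamma>\<^sub>1 * t, x - (2 * \<gamma>\<^sub>1) * t} \<subseteq> A"
      by (elim exE conjE)
    from *[OF this] show "\<exists>x t. t \<noteq> 0 \<and> {x, x - \<gamma>\<^sub>1 * t, x - \<gamma>\<^sub>2 * t} \<subseteq> A"
      by (rule exI)
  qed
qed

end
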